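(* Let $n\ge 2$, let $g\in\mathrm{PGL}(n+1,\mathbb{C})$ be an element of infinite order, and let $S\subset\mathbb{CP}^n$ be a non-degenerate irreducible rational complex algebraic curve invariant under $g$. Then $S$ is projectively equivalent to a monomial set.
   Context: A curve in $\mathbb{CP}^n$ is non-degenerate if it is not contained in any hyperplane; it is invariant under $g$ if $g(S)=S$; it is rational if its normalization is $\mathbb{CP}^1$. A monomial set in $\mathbb{CP}^n$ is the image of a monomial curve, i.e. of a map $\xi_{\mathbf{k}}:\mathbb{CP}^1\to\mathbb{CP}^n$, $\xi_{\mathbf{k}}([z:w])=[z^{k_1}:z^{k_2}w^{k_1-k_2}:\cdots:z^{k_n}w^{k_1-k_n}:w^{k_1}]$, where $\mathbf{k}=(k_1,\ldots,k_n)$ is a tuple of natural numbers with $k_1>\cdots>k_n>0$. Two subsets of $\mathbb{CP}^n$ are projectively equivalent if some element of $\mathrm{PGL}(n+1,\mathbb{C})$ maps one onto the other. *)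

theory Defs
  imports
    "Jordan_Normal_Form.Matrix"
    "HOL-Library.Poly_Mapping"
    "HOL-Library.Extended_Nat"
    "HOL-Algebra.Multiplicative_Group"
begin

section \<open>Projective space and projective transformations\<close>

text \<open>A point of \<open>CP\<close> \<open>n\<close> is the set of its homogeneous coordinate vectors, i.e. a line through
  the origin of \<open>C^(n+1)\<close> with the origin removed. Coordinates are numbered from 0 to \<open>n\<close>.\<close>

type_synonym point = "complex vec set"

definition proj_point :: "complex vec \<Rightarrow> point" where
  "proj_point v = {c \<cdot>\<^sub>v v | c. c \<noteq> 0}"

definition CP :: "nat \<Rightarrow> point set" where
  "CP n = proj_point ` (carrier_vec (Suc n) - {0\<^sub>v (Suc n)})"

definition GL :: "nat \<Rightarrow> complex mat monoid" where
  "GL m = units_of (ring_mat TYPE(complex) m ())"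

definition scalar_mats :: "nat \<Rightarrow> complex mat set" where
  "scalar_mats m = {c \<cdot>\<^sub>m 1\<^sub>m m | c. c \<noteq> 0}"

definition PGL :: "nat \<Rightarrow> complex mat set monoid" where
  "PGL m = GL m Mod scalar_mats m"

lemma group_GL: "group (GL m)"
proof -
  interpret R: ring "ring_mat TYPE(complex) m ()" by (rule ring_mat)
  show ?thesis unfolding GL_def by (rule R.units_group)
qed

lemma GL_carrier_mat: "A \<in> carrier (GL m) \<Longrightarrow> A \<in> carrier_mat m m"
  by (auto simp: GL_def units_of_def Units_def ring_mat_def)

lemma GL_mult: "A \<otimes>\<^bsub>GL m\<^esub> B = A * B" and GL_one: "\<one>\<^bsub>GL m\<^esub> = 1\<^sub>m m"
  by (auto simp: GL_def units_of_def ring_mat_def)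

lemma scalar_mult_scalar:
  "(c \<cdot>\<^sub>m 1\<^sub>m m) * (d \<cdot>\<^sub>m 1\<^sub>m m) = ((c * d) \<cdot>\<^sub>m 1\<^sub>m m :: complex mat)"
proof -
  have "(c \<cdot>\<^sub>m 1\<^sub>m m) * (d \<cdot>\<^sub>m 1\<^sub>m m) = c \<cdot>\<^sub>m (d \<cdot>\<^sub>m 1\<^sub>m m :: complex mat)"
    by (subst mult_smult_assoc_mat[of _ m m _ m]) auto
  then show ?thesis by (auto intro!: eq_matI)
qed

lemma scalar_mats_subset: "scalar_mats m \<subseteq> carrier (GL m)"
proof
  fix A assume "A \<in> scalar_mats m"
  then obtain c where c: "c \<noteq> 0" "A = c \<cdot>\<^sub>m 1\<^sub>m m" by (auto simp: scalar_mats_def)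
  have "A * (inverse c \<cdot>\<^sub>m 1\<^sub>m m) = 1\<^sub>m m" "(inverse c \<cdot>\<^sub>m 1\<^sub>m m) * A = 1\<^sub>m m"
    using c by (simp_all only: scalar_mult_scalar) (auto intro!: eq_matI)
  moreover have "A \<in> carrier_mat m m" "inverse c \<cdot>\<^sub>m 1\<^sub>m m \<in> carrier_mat m m" using c by auto
  ultimately show "A \<in> carrier (GL m)"
    by (auto simp: GL_def units_of_def Units_def ring_mat_def)
qed

lemma scalar_commutes:
  assumes "S \<in> scalar_mats m" "A \<in> carrier_mat m m"
  shows "S * A = A * S"
proof -
  obtain c where c: "S = c \<cdot>\<^sub>m 1\<^sub>m m" using assms by (auto simp: scalar_mats_def)
  have "S * A = c \<cdot>\<^sub>m A"
    unfolding c using assms(2) by (subst mult_smult_assoc_mat[of _ m m _ m]) auto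
  moreover have "A * S = c \<cdot>\<^sub>m A"
    unfolding c using assms(2) by (subst mult_smult_distrib[of _ m m _ m]) auto
  ultimately show ?thesis by simp
qed

lemma subgroup_scalar_mats: "subgroup (scalar_mats m) (GL m)"
proof -
  interpret G: group "GL m" by (rule group_GL)
  show ?thesis
  proof (rule G.subgroupI[OF scalar_mats_subset])
    show "scalar_mats m \<noteq> {}" unfolding scalar_mats_def by (auto intro: exI[of _ 1])
  next
    fix A assume A: "A \<in> scalar_mats m"
    then obtain c where c: "c \<noteq> 0" "A = c \<cdot>\<^sub>m 1\<^sub>m m" by (auto simp: scalar_mats_def)
    let ?B = "inverse c \<cdot>\<^sub>m 1\<^sub>m m :: complex mat"
    have B: "?B \<in> scalar_mats m" using c by (auto simp: scalar_mats_def)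
    have "?B \<otimes>\<^bsub>GL m\<^esub> A = \<one>\<^bsub>GL m\<^esub>"
      using c by (simp only: GL_mult GL_one scalar_mult_scalar) (auto intro!: eq_matI)
    then have "inv\<^bsub>GL m\<^esub> A = ?B"
      using G.inv_equality A B scalar_mats_subset by blast
    then show "inv\<^bsub>GL m\<^esub> A \<in> scalar_mats m" using B by simp
  next
    fix A B assume "A \<in> scalar_mats m" "B \<in> scalar_mats m"
    then obtain c d where "c \<noteq> 0" "A = c \<cdot>\<^sub>m 1\<^sub>m m" "d \<noteq> 0" "B = d \<cdot>\<^sub>m 1\<^sub>m m"
      by (auto simp: scalar_mats_def)
    then show "A \<otimes>\<^bsub>GL m\<^esub> B \<in> scalar_mats m"
      unfolding GL_mult by (simp only: scalar_mult_scalar) (auto simp: scalar_mats_def)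
  qed
qed

lemma normal_scalar_mats: "scalar_mats m \<lhd> GL m"
proof -
  interpret G: group "GL m" by (rule group_GL)
  show ?thesis
  proof (rule G.normalI[OF subgroup_scalar_mats], intro ballI)
    fix A assume "A \<in> carrier (GL m)"
    then have "S * A = A * S" if "S \<in> scalar_mats m" for S
      using that scalar_commutes GL_carrier_mat by blast
    then show "scalar_mats m #>\<^bsub>GL m\<^esub> A = A <#\<^bsub>GL m\<^esub> scalar_mats m"
      unfolding r_coset_def l_coset_def GL_mult by simp
  qed
qed

lemma group_PGL: "group (PGL m)"
  unfolding PGL_def by (rule normal.factorgroup_is_group[OF normal_scalar_mats])

definition PGL_act :: "complex mat set \<Rightarrow> point \<Rightarrow> point" where
  "PGL_act g P = {A *\<^sub>v v | A v. A \<in> g \<and> v \<in> P}"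

lemma PGL_act_coset:
  assumes A: "A \<in> carrier (GL m)" and v: "v \<in> carrier_vec m"
  shows "PGL_act (scalar_mats m #>\<^bsub>GL m\<^esub> A) (proj_point v) = proj_point (A *\<^sub>v v)"
proof -
  have A': "A \<in> carrier_mat m m" using A by (rule GL_carrier_mat)
  have eq: "((c \<cdot>\<^sub>m 1\<^sub>m m) * A) *\<^sub>v (d \<cdot>\<^sub>v v) = (c * d) \<cdot>\<^sub>v (A *\<^sub>v v)" for c d
  proof -
    have "(c \<cdot>\<^sub>m 1\<^sub>m m) * A = c \<cdot>\<^sub>m A"
      using A' by (subst mult_smult_assoc_mat[of _ m m _ m]) auto
    then show ?thesis
      using A' v by (auto intro!: eq_vecI simp: mult_mat_vec_def)
  qed
  show ?thesis
  proof (intro equalityI subsetI)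
    fix w assume "w \<in> PGL_act (scalar_mats m #>\<^bsub>GL m\<^esub> A) (proj_point v)"
    then obtain c d where "c \<noteq> 0" "d \<noteq> 0" "w = ((c \<cdot>\<^sub>m 1\<^sub>m m) * A) *\<^sub>v (d \<cdot>\<^sub>v v)"
      by (auto simp: PGL_act_def r_coset_def GL_mult scalar_mats_def proj_point_def)
    then show "w \<in> proj_point (A *\<^sub>v v)"
      unfolding eq by (auto simp: proj_point_def)
  next
    fix w assume "w \<in> proj_point (A *\<^sub>v v)"
    then obtain c where c: "c \<noteq> 0" "w = c \<cdot>\<^sub>v (A *\<^sub>v v)" by (auto simp: proj_point_def)
    then have "w = ((c \<cdot>\<^sub>m 1\<^sub>m m) * A) *\<^sub>v (1 \<cdot>\<^sub>v v)" unfolding eq by simp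
    moreover have "(c \<cdot>\<^sub>m 1\<^sub>m m) * A \<in> scalar_mats m #>\<^bsub>GL m\<^esub> A"
      using c by (auto simp: r_coset_def GL_mult scalar_mats_def)
    moreover have "1 \<cdot>\<^sub>v v \<in> proj_point v" unfolding proj_point_def by force
    ultimately show "w \<in> PGL_act (scalar_mats m #>\<^bsub>GL m\<^esub> A) (proj_point v)"
      unfolding PGL_act_def by blast
  qed
qed

definition projectively_equivalent :: "nat \<Rightarrow> point set \<Rightarrow> point set \<Rightarrow> bool" where
  "projectively_equivalent n S T \<longleftrightarrow>
     S \<subseteq> CP n \<and> T \<subseteq> CP n \<and> (\<exists>h \<in> carrier (PGL (Suc n)). PGL_act h ` S = T)"

definition hyperplane :: "nat \<Rightarrow> point set \<Rightarrow> bool" where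
  "hyperplane n H \<longleftrightarrow>
     (\<exists>a \<in> carrier_vec (Suc n). a \<noteq> 0\<^sub>v (Suc n) \<and> H = {P \<in> CP n. \<forall>v\<in>P. a \<bullet> v = 0})"

definition nondegenerate :: "nat \<Rightarrow> point set \<Rightarrow> bool" where
  "nondegenerate n S \<longleftrightarrow> \<not> (\<exists>H. hyperplane n H \<and> S \<subseteq> H)"


section \<open>The Zariski topology\<close>

text \<open>A polynomial is a finitely supported map from exponent vectors (themselves finitely supported
  maps from variable indices to exponents) to coefficients.\<close>

type_synonym cpoly = "(nat \<Rightarrow>\<^sub>0 nat) \<Rightarrow>\<^sub>0 complex"

definition poly_eval :: "cpoly \<Rightarrow> complex vec \<Rightarrow> complex" where
  "poly_eval p v = (\<Sum>m \<in> Poly_Mapping.keys p. Poly_Mapping.lookup p m *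
     (\<Prod>i \<in> Poly_Mapping.keys m. (v $ i) ^ Poly_Mapping.lookup m i))"

definition homog :: "nat \<Rightarrow> nat \<Rightarrow> cpoly set" where
  "homog n d = {p. \<forall>m \<in> Poly_Mapping.keys p. Poly_Mapping.keys m \<subseteq> {..n} \<and>
     (\<Sum>i \<in> Poly_Mapping.keys m. Poly_Mapping.lookup m i) = d}"

definition zariski_closed :: "nat \<Rightarrow> point set \<Rightarrow> bool" where
  "zariski_closed n Z \<longleftrightarrow>
     (\<exists>F \<subseteq> (\<Union>d. homog n d). Z = {P \<in> CP n. \<forall>p\<in>F. \<forall>v\<in>P. poly_eval p v = 0})"

definition zariski_open_in :: "nat \<Rightarrow> point set \<Rightarrow> point set \<Rightarrow> bool" where
  "zariski_open_in n X U \<longleftrightarrow> (\<exists>Z. zariski_closed n Z \<and> U = X - Z)"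

definition zariski_irreducible :: "nat \<Rightarrow> point set \<Rightarrow> bool" where
  "zariski_irreducible n X \<longleftrightarrow> X \<noteq> {} \<and>
     (\<forall>Y Z. zariski_closed n Y \<and> zariski_closed n Z \<and> X \<subseteq> Y \<union> Z \<longrightarrow> X \<subseteq> Y \<or> X \<subseteq> Z)"

text \<open>The Krull dimension of a closed set: the supremum of the lengths of chains of irreducible
  closed subsets.\<close>

definition zariski_dim :: "nat \<Rightarrow> point set \<Rightarrow> enat" where
  "zariski_dim n X = Sup {enat k | k. \<exists>Z.
     (\<forall>i\<le>k. zariski_closed n (Z i) \<and> zariski_irreducible n (Z i) \<and> Z i \<subseteq> X) \<and>
     (\<forall>i<k. Z i \<subset> Z (Suc i))}"

definition irreducible_curve :: "nat \<Rightarrow> point set \<Rightarrow> bool" where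
  "irreducible_curve n S \<longleftrightarrow>
     zariski_closed n S \<and> zariski_irreducible n S \<and> zariski_dim n S = 1"

definition quasi_projective :: "nat \<Rightarrow> point set \<Rightarrow> bool" where
  "quasi_projective n X \<longleftrightarrow> (\<exists>Z. zariski_closed n Z \<and> zariski_open_in n Z X)"


section \<open>Regular functions and regular maps\<close>

definition regular_fun :: "nat \<Rightarrow> point set \<Rightarrow> (point \<Rightarrow> complex) \<Rightarrow> bool" where
  "regular_fun n X f \<longleftrightarrow>
     (\<forall>P\<in>X. \<exists>U d. \<exists>p \<in> homog n d. \<exists>q \<in> homog n d. zariski_open_in n X U \<and> P \<in> U \<and>
        (\<forall>Q\<in>U. \<forall>v\<in>Q. poly_eval q v \<noteq> 0 \<and> f Q = poly_eval p v / poly_eval q v))"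

definition regular_map ::
  "nat \<Rightarrow> point set \<Rightarrow> nat \<Rightarrow> point set \<Rightarrow> (point \<Rightarrow> point) \<Rightarrow> bool" where
  "regular_map m X n Y f \<longleftrightarrow> f ` X \<subseteq> Y \<and>
     (\<forall>P\<in>X. \<exists>U d F. zariski_open_in m X U \<and> P \<in> U \<and> (\<forall>i\<le>n. F i \<in> homog m d) \<and>
        (\<forall>Q\<in>U. \<forall>v\<in>Q. (\<exists>i\<le>n. poly_eval (F i) v \<noteq> 0) \<and>
           f Q = proj_point (vec (Suc n) (\<lambda>i. poly_eval (F i) v))))"

definition biregular_map ::
  "nat \<Rightarrow> point set \<Rightarrow> nat \<Rightarrow> point set \<Rightarrow> (point \<Rightarrow> point) \<Rightarrow> bool" where
  "biregular_map m X n Y f \<longleftrightarrow> regular_map m X n Y f \<and>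
     (\<exists>h. regular_map n Y m X h \<and> (\<forall>P\<in>X. h (f P) = P) \<and> (\<forall>Q\<in>Y. f (h Q) = Q))"

text \<open>For irreducible quasi-projective \<open>X\<close> and \<open>Y\<close>: an isomorphism between nonempty open subsets.\<close>

definition birational_map ::
  "nat \<Rightarrow> point set \<Rightarrow> nat \<Rightarrow> point set \<Rightarrow> (point \<Rightarrow> point) \<Rightarrow> bool" where
  "birational_map m X n Y f \<longleftrightarrow> regular_map m X n Y f \<and>
     (\<exists>U V. zariski_open_in m X U \<and> U \<noteq> {} \<and> zariski_open_in n Y V \<and> V \<noteq> {} \<and>
        biregular_map m U n V f)"


section \<open>Normalization\<close>

text \<open>Affine space \<open>A^N\<close> is the chart of \<open>CP\<close> \<open>N\<close> where coordinate 0 does not vanish.\<close>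

definition affine_space :: "nat \<Rightarrow> point set" where
  "affine_space N = {P \<in> CP N. \<forall>v\<in>P. v $ 0 \<noteq> 0}"

definition affine_variety :: "nat \<Rightarrow> point set \<Rightarrow> bool" where
  "affine_variety n X \<longleftrightarrow> quasi_projective n X \<and>
     (\<exists>N C f. zariski_closed N C \<and> biregular_map n X N (C \<inter> affine_space N) f)"

text \<open>Finite maps: locally over the target, the preimage of a suitable affine open set \<open>V\<close> is affine
  and its coordinate ring is integral over that of \<open>V\<close>. A coordinate ring is a finitely generated
  algebra, so here integrality is the same as being a finitely generated module.\<close>

definition finite_map ::
  "nat \<Rightarrow> point set \<Rightarrow> nat \<Rightarrow> point set \<Rightarrow> (point \<Rightarrow> point) \<Rightarrow> bool" where
  "finite_map m X n Y f \<longleftrightarrow> regular_map m X n Y f \<and>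
     (\<forall>P\<in>Y. \<exists>V. zariski_open_in n Y V \<and> P \<in> V \<and> affine_variety n V \<and>
        affine_variety m {Q \<in> X. f Q \<in> V} \<and>
        (\<forall>h. regular_fun m {Q \<in> X. f Q \<in> V} h \<longrightarrow>
           (\<exists>(k::nat) a. (\<forall>i<k. regular_fun n V (a i)) \<and>
              (\<forall>Q\<in>X. f Q \<in> V \<longrightarrow> h Q ^ k + (\<Sum>i<k. a i (f Q) * h Q ^ i) = 0))))"

text \<open>An irreducible \<open>X\<close> is normal if every local ring is integrally closed in the function field.
  Elements of the function field are represented by regular functions \<open>r\<close> on nonempty open sets
  \<open>U\<close>, elements of the local ring at \<open>P\<close> by regular functions on open neighbourhoods of \<open>P\<close>.\<close>

definition normal_variety :: "nat \<Rightarrow> point set \<Rightarrow> bool" where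
  "normal_variety n X \<longleftrightarrow> quasi_projective n X \<and> zariski_irreducible n X \<and>
     (\<forall>P\<in>X. \<forall>U r W (k::nat) a.
        zariski_open_in n X U \<and> U \<noteq> {} \<and> regular_fun n U r \<and>
        zariski_open_in n X W \<and> P \<in> W \<and> (\<forall>i<k. regular_fun n W (a i)) \<and>
        (\<forall>Q \<in> U \<inter> W. r Q ^ k + (\<Sum>i<k. a i Q * r Q ^ i) = 0) \<longrightarrow>
        (\<exists>W' s. zariski_open_in n X W' \<and> P \<in> W' \<and> regular_fun n W' s \<and>
           (\<forall>Q \<in> U \<inter> W'. s Q = r Q)))"

text \<open>A normalization of an irreducible variety \<open>Y\<close> is a finite birational map onto \<open>Y\<close> from a
  normal variety. (Surjectivity is automatic for finite dominant maps.)\<close>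

definition normalization_map ::
  "nat \<Rightarrow> point set \<Rightarrow> nat \<Rightarrow> point set \<Rightarrow> (point \<Rightarrow> point) \<Rightarrow> bool" where
  "normalization_map m X n Y f \<longleftrightarrow> normal_variety m X \<and>
     finite_map m X n Y f \<and> birational_map m X n Y f \<and> f ` X = Y"

text \<open>The normalization is unique up to isomorphism, so it being \<open>CP^1\<close> means that \<open>CP 1\<close> together
  with some map is a normalization.\<close>

definition rational_curve :: "nat \<Rightarrow> point set \<Rightarrow> bool" where
  "rational_curve n S \<longleftrightarrow> irreducible_curve n S \<and> (\<exists>f. normalization_map 1 (CP 1) n S f)"


section \<open>Monomial curves\<close>

text \<open>The tuple \<open>(k_1, \<dots>, k_n)\<close> is the list \<open>ks\<close>; appending 0 makes \<open>k_1\<close>, \<dots>, \<open>k_n\<close>, 0 the exponents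
  of \<open>z\<close> in the \<open>n + 1\<close> coordinates, and all coordinates have degree \<open>k_1\<close>.\<close>

definition monomial_exponents :: "nat \<Rightarrow> nat list \<Rightarrow> bool" where
  "monomial_exponents n ks \<longleftrightarrow> length ks = n \<and> sorted_wrt (>) ks \<and> (\<forall>k \<in> set ks. k > 0)"

definition monomial_vec :: "nat list \<Rightarrow> complex \<Rightarrow> complex \<Rightarrow> complex vec" where
  "monomial_vec ks z w =
     vec (Suc (length ks)) (\<lambda>j. z ^ ((ks @ [0]) ! j) * w ^ (hd ks - (ks @ [0]) ! j))"

text \<open>All \<open>v\<close> in \<open>P\<close> contribute the same point to the union.\<close>

definition monomial_curve :: "nat list \<Rightarrow> point \<Rightarrow> point" where
  "monomial_curve ks P = (\<Union>v\<in>P. proj_point (monomial_vec ks (v $ 0) (v $ 1)))"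

definition monomial_set :: "nat \<Rightarrow> point set \<Rightarrow> bool" where
  "monomial_set n T \<longleftrightarrow> (\<exists>ks. monomial_exponents n ks \<and> T = monomial_curve ks ` CP 1)"

end

theory Submission
  imports Defs "Jordan_Normal_Form.Determinant"
    "HOL-Computational_Algebra.Fundamental_Theorem_Algebra"
begin

text \<open>
  Let \<open>f\<close> be the normalization map from the projective line to \<open>S\<close>. It is given by forms
  \<open>F_0, \<dots>, F_n\<close> of one degree \<open>d\<close> without a common zero (\<open>regular_map_global_forms\<close>).
  Since \<open>f\<close> is birational, the matrix \<open>A\<close> of \<open>g\<close> induces a rational map \<open>\<gamma>\<close> from the line to
  itself with \<open>f \<circ> \<gamma> = g \<circ> f\<close> wherever both sides make sense, and \<open>\<gamma>\<close> is given by two forms of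
  some degree \<open>e\<close> without a common zero. The tuples \<open>F \<circ> \<gamma>\<close> and \<open>A F\<close> have degrees \<open>d e\<close> and \<open>d\<close>,
  have no base points, and are proportional at almost all points; their quotient has
  neither zeros nor poles, so they differ by a constant factor (\<open>proportional_tuples\<close>).
  Comparing degrees gives \<open>e = 1\<close>, so \<open>\<gamma>\<close> is linear: \<open>A F(v) = c F(M v)\<close> for an invertible \<open>2 \<times> 2\<close> matrix \<open>M\<close> (\<open>lift_linear\<close>).

  A linear change of the parameter puts \<open>M\<close> into Jordan form (\<open>normal_form_2x2\<close>). Now write
  \<open>F(z, w) = \<Sum>k\<le>d. z^k w^(d-k) u_k\<close> with coefficient vectors \<open>u_k\<close>, which span the whole space because
  \<open>S\<close> is non-degenerate. If \<open>M\<close> is diagonal with eigenvalues \<open>l\<close>, \<open>m\<close>, then \<open>u_k\<close>, unless it is zero, is an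
  eigenvector of \<open>A\<close> for \<open>c l^k m^(d-k)\<close>; these eigenvalues are distinct, since otherwise \<open>l/m\<close> would be a
  root of unity and a power of \<open>A\<close> would be scalar, against the infinite order of \<open>g\<close>. So the nonzero
  \<open>u_k\<close> are linearly independent. If \<open>M\<close> is a Jordan block, then \<open>A\<close>, divided by a scalar,
  maps \<open>u_k\<close> to \<open>u_k + (k + 1) u_(k+1) + \<dots>\<close>, because \<open>M\<close> amounts to the substitution of \<open>z + 1\<close> for \<open>z\<close> at
  \<open>w = 1\<close>. Subtracting the identity shifts upwards, and as \<open>u_d\<close> is not zero, all \<open>u_k\<close> are linearly
  independent (\<open>unipotent_independent\<close>).

  In both cases the nonzero \<open>u_k\<close> form a basis. In the coordinates of this basis \<open>F\<close> is a list of
  distinct monomials; absence of base points says that \<open>z^d\<close> and \<open>w^d\<close> are among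
  them, and that is what being a monomial curve means (\<open>monomial_if_coefficient_basis\<close>). In the second
  case one obtains the rational normal curve.
\<close>

section \<open>Binary forms\<close>

definition homogenize :: "nat \<Rightarrow> complex poly \<Rightarrow> complex \<Rightarrow> complex \<Rightarrow> complex" where
  "homogenize d q z w = (\<Sum>k\<le>d. coeff q k * z ^ k * w ^ (d - k))"

text \<open>A form is represented by the function that it induces on pairs, so that substitution of forms
  into forms is composition of functions; the polynomial \<open>q\<close> is the dehomogenization at \<open>w = 1\<close>.\<close>

definition binary_form :: "nat \<Rightarrow> (complex \<Rightarrow> complex \<Rightarrow> complex) \<Rightarrow> bool" where
  "binary_form d \<phi> \<longleftrightarrow> (\<exists>q. degree q \<le> d \<and> \<phi> = homogenize d q)"

lemma homogenize_affine:
  assumes "degree q \<le> d" "w \<noteq> 0"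
  shows "homogenize d q z w = w ^ d * poly q (z / w)"
proof -
  have "poly q (z / w) = (\<Sum>k\<le>d. coeff q k * (z / w) ^ k)"
    unfolding poly_altdef using assms(1) by (intro sum.mono_neutral_left) (auto simp: coeff_eq_0)
  moreover have "w ^ d * (coeff q k * (z / w) ^ k) = coeff q k * z ^ k * w ^ (d - k)" if "k \<le> d" for k
    using that assms(2) by (simp add: power_divide power_diff)
  ultimately show ?thesis
    unfolding homogenize_def by (simp only: sum_distrib_left) (intro sum.cong refl, simp only: atMost_iff)
qed

lemma homogenize_at_infinity: "homogenize d q z 0 = coeff q d * z ^ d"
proof -
  have "homogenize d q z 0 = (\<Sum>k\<le>d. if k = d then coeff q d * z ^ d else 0)"
    unfolding homogenize_def by (intro sum.cong) auto
  then show ?thesis by simp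
qed

lemma homogenize_one: "degree q \<le> d \<Longrightarrow> homogenize d q z 1 = poly q z"
  by (simp add: homogenize_affine)

lemma coeff_mult_top:
  fixes p q :: "complex poly"
  assumes "degree p \<le> d" "degree q \<le> e"
  shows "coeff (p * q) (d + e) = coeff p d * coeff q e"
proof -
  have "coeff (p * q) (d + e) = (\<Sum>i\<le>d + e. if i = d then coeff p d * coeff q e else 0)"
    unfolding coeff_mult
  proof (intro sum.cong refl)
    fix i assume "i \<in> {..d + e}"
    show "coeff p i * coeff q (d + e - i) = (if i = d then coeff p d * coeff q e else 0)"
    proof (cases i d rule: linorder_cases)
      case less
      then have "coeff q (d + e - i) = 0" using assms by (intro coeff_eq_0) auto
      then show ?thesis using less by simp
    next
      case greater
      then show ?thesis using assms by (simp add: coeff_eq_0)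
    qed auto
  qed
  then show ?thesis by simp
qed

lemma homogenize_mult:
  assumes "degree p \<le> d" "degree q \<le> e"
  shows "homogenize (d + e) (p * q) z w = homogenize d p z w * homogenize e q z w"
proof (cases "w = 0")
  case True
  then show ?thesis using assms by (simp add: homogenize_at_infinity coeff_mult_top power_add)
next
  case False
  have "degree (p * q) \<le> d + e" using assms degree_mult_le[of p q] by linarith
  then show ?thesis using assms False by (simp add: homogenize_affine power_add)
qed

lemma binary_form_mult:
  assumes "binary_form d \<phi>" "binary_form e \<psi>"
  shows "binary_form (d + e) (\<lambda>z w. \<phi> z w * \<psi> z w)"
proof -
  obtain p q where "degree p \<le> d" "\<phi> = homogenize d p" "degree q \<le> e" "\<psi> = homogenize e q"
    using assms by (auto simp: binary_form_def)
  moreover from this have "degree (p * q) \<le> d + e" using degree_mult_le[of p q] by linarith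
  ultimately show ?thesis unfolding binary_form_def
    by (intro exI[of _ "p * q"]) (auto simp: homogenize_mult fun_eq_iff)
qed

lemma binary_form_add:
  assumes "binary_form d \<phi>" "binary_form d \<psi>"
  shows "binary_form d (\<lambda>z w. \<phi> z w + \<psi> z w)"
proof -
  obtain p q where "degree p \<le> d" "\<phi> = homogenize d p" "degree q \<le> d" "\<psi> = homogenize d q"
    using assms by (auto simp: binary_form_def)
  then show ?thesis unfolding binary_form_def
    by (intro exI[of _ "p + q"])
       (auto simp: homogenize_def fun_eq_iff degree_add_le sum.distrib algebra_simps)
qed

lemma binary_form_const: "binary_form 0 (\<lambda>z w. c)"
  unfolding binary_form_def by (intro exI[of _ "[:c:]"]) (auto simp: homogenize_def fun_eq_iff)

lemma binary_form_zero: "binary_form d (\<lambda>z w. 0)"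
  unfolding binary_form_def by (intro exI[of _ 0]) (auto simp: homogenize_def fun_eq_iff)

lemma binary_form_linear: "binary_form 1 (\<lambda>z w. a * z + b * w)"
  unfolding binary_form_def by (intro exI[of _ "[:b, a:]"]) (auto simp: homogenize_def fun_eq_iff)

lemma binary_form_scale: "binary_form d \<phi> \<Longrightarrow> binary_form d (\<lambda>z w. c * \<phi> z w)"
  using binary_form_mult[OF binary_form_const] by simp

lemma binary_form_power: "binary_form d \<phi> \<Longrightarrow> binary_form (d * k) (\<lambda>z w. \<phi> z w ^ k)"
  by (induction k) (auto intro: binary_form_mult binary_form_const)

lemma binary_form_sum:
  "(\<And>i. i \<in> I \<Longrightarrow> binary_form d (\<phi> i)) \<Longrightarrow> binary_form d (\<lambda>z w. \<Sum>i\<in>I. \<phi> i z w)"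
  by (induction I rule: infinite_finite_induct) (auto intro: binary_form_zero binary_form_add)

lemma binary_form_prod:
  "(\<And>i. i \<in> I \<Longrightarrow> binary_form (d i) (\<phi> i)) \<Longrightarrow>
    binary_form (\<Sum>i\<in>I. d i) (\<lambda>z w. \<Prod>i\<in>I. \<phi> i z w)"
  by (induction I rule: infinite_finite_induct) (auto intro: binary_form_const binary_form_mult)

lemma binary_form_compose:
  assumes "binary_form d \<phi>" "binary_form e R" "binary_form e T"
  shows "binary_form (d * e) (\<lambda>z w. \<phi> (R z w) (T z w))"
proof -
  obtain q where q: "\<phi> = homogenize d q" using assms by (auto simp: binary_form_def)
  have "binary_form (d * e) (\<lambda>z w. coeff q k * (R z w ^ k * T z w ^ (d - k)))" if "k \<le> d" for k
  proof -
    have "binary_form (e * k + e * (d - k)) (\<lambda>z w. R z w ^ k * T z w ^ (d - k))"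
      by (intro binary_form_mult binary_form_power assms)
    moreover have "e * k + e * (d - k) = d * e"
      using that by (metis add_mult_distrib2 le_add_diff_inverse mult.commute)
    ultimately show ?thesis by (auto intro: binary_form_scale)
  qed
  then show ?thesis
    unfolding q homogenize_def by (intro binary_form_sum) (simp add: mult.assoc)
qed

text \<open>A form is determined by its dehomogenization, hence by almost all of its values on the affine
  line \<open>w = 1\<close>. All genericity statements below are therefore about almost all \<open>z\<close> at \<open>w = 1\<close>.\<close>

lemma binary_form_eq:
  assumes "binary_form d \<phi>" "binary_form d \<psi>" "\<forall>\<^sub>F z in cofinite. \<phi> z 1 = \<psi> z 1"
  shows "\<phi> z w = \<psi> z w"
proof -
  obtain p q where pq: "degree p \<le> d" "\<phi> = homogenize d p" "degree q \<le> d" "\<psi> = homogenize d q"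
    using assms by (auto simp: binary_form_def)
  have "finite {z. poly (p - q) z \<noteq> 0}"
    using assms(3) pq by (simp add: eventually_cofinite homogenize_one)
  then have "finite (- {z. poly (p - q) z = 0})" by (simp add: Collect_neg_eq)
  then have "infinite {z. poly (p - q) z = 0}"
    using infinite_UNIV_char_0[where ?'a = complex] by (metis Compl_partition finite_Un)
  then have "p - q = 0" using poly_roots_finite by blast
  then show ?thesis using pq by simp
qed

lemma binary_form_generic_nonzero:
  assumes "binary_form d \<phi>" "\<phi> z0 w0 \<noteq> 0"
  shows "\<forall>\<^sub>F z in cofinite. \<phi> z 1 \<noteq> 0"
proof -
  obtain p where p: "degree p \<le> d" "\<phi> = homogenize d p"
    using assms by (auto simp: binary_form_def)
  then have "p \<noteq> 0" using assms(2) by (auto simp: homogenize_def)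
  then show ?thesis using p poly_roots_finite[of p]
    by (simp add: eventually_cofinite homogenize_one)
qed

lemma binary_form_degree_0: "binary_form 0 \<phi> \<Longrightarrow> \<phi> z w = \<phi> z' w'"
  by (auto simp: binary_form_def homogenize_def)

lemma binary_form_factor_root:
  assumes \<phi>: "binary_form d \<phi>" and root: "\<phi> a b = 0" and ab: "a \<noteq> 0 \<or> b \<noteq> 0" and d: "d > 0"
  shows "\<exists>\<psi>. binary_form (d - 1) \<psi> \<and> (\<forall>z w. \<phi> z w = (b * z - a * w) * \<psi> z w)"
proof -
  obtain q where q: "degree q \<le> d" "\<phi> = homogenize d q"
    using \<phi> by (auto simp: binary_form_def)
  obtain r where r: "q = [:-a, b:] * r" "degree r \<le> d - 1"
  proof (cases "b = 0")
    case True
    then have "a \<noteq> 0" using ab by simp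
    then have "coeff q d = 0" using root True q by (simp add: homogenize_at_infinity)
    then have "degree q \<le> d - 1"
      using q(1) d by (metis Suc_pred' degree_le le_degree less_Suc_eq_le not_less_eq_eq coeff_eq_0 le_antisym linorder_not_le)
    then show ?thesis
      using that[of "smult (- 1 / a) q"] True \<open>a \<noteq> 0\<close> by simp
  next
    case False
    then have "poly q (a / b) = 0" using root q by (simp add: homogenize_affine)
    then obtain r where r: "q = [:- (a / b), 1:] * r" by (metis dvdE poly_eq_0_iff_dvd)
    have "degree r \<le> d - 1"
      using q(1) r by (cases "r = 0") (simp_all add: degree_mult_eq del: mult_pCons_left)
    moreover have "[:-a, b:] * smult (1 / b) r = smult (1 / b) [:-a, b:] * r"
      by (simp only: mult_smult_left mult_smult_right)
    moreover have "smult (1 / b) [:-a, b:] = [:- (a / b), 1:]" using False by simp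
    ultimately show ?thesis
      using that[of "smult (1 / b) r"] r by simp
  qed
  have "\<phi> z w = (b * z - a * w) * homogenize (d - 1) r z w" for z w
    using homogenize_mult[of "[:-a, b:]" 1 r "d - 1" z w] r d q
    by (simp add: homogenize_def)
  then show ?thesis using r by (auto simp: binary_form_def)
qed

section \<open>Tuples of forms without base points\<close>

definition form_tuple :: "nat \<Rightarrow> nat \<Rightarrow> (nat \<Rightarrow> complex \<Rightarrow> complex \<Rightarrow> complex) \<Rightarrow> bool" where
  "form_tuple m d F \<longleftrightarrow> (\<forall>i<m. binary_form d (F i))"

definition base_point_free :: "nat \<Rightarrow> (nat \<Rightarrow> complex \<Rightarrow> complex \<Rightarrow> complex) \<Rightarrow> bool" where
  "base_point_free m F \<longleftrightarrow> (\<forall>z w. z \<noteq> 0 \<or> w \<noteq> 0 \<longrightarrow> (\<exists>i<m. F i z w \<noteq> 0))"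

text \<open>A common zero \<open>[a:b]\<close> of all entries allows the linear form \<open>b z - a w\<close> to be divided out; each division
  lowers the degree, so this ends with a tuple that has no base points.\<close>

lemma remove_base_points:
  assumes "form_tuple m d F" "\<exists>i<m. \<exists>z w. F i z w \<noteq> 0"
  shows "\<exists>e G K. form_tuple m e G \<and> base_point_free m G \<and>
           (\<forall>i<m. \<forall>z w. F i z w = K z w * G i z w)"
  using assms
proof (induction d arbitrary: F)
  case 0
  then have "base_point_free m F"
    unfolding base_point_free_def form_tuple_def by (metis binary_form_degree_0)
  then show ?case using 0 by (intro exI[of _ 0] exI[of _ F] exI[of _ "\<lambda>_ _. 1"]) simp
next
  case (Suc d)
  show ?case
  proof (cases "base_point_free m F")
    case True
    then show ?thesis using Suc by (intro exI[of _ "Suc d"] exI[of _ F] exI[of _ "\<lambda>_ _. 1"]) simp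
  next
    case False
    then obtain a b where ab: "a \<noteq> 0 \<or> b \<noteq> 0" "\<forall>i<m. F i a b = 0"
      by (auto simp: base_point_free_def)
    have "\<forall>i. \<exists>\<psi>. i < m \<longrightarrow> binary_form d \<psi> \<and> (\<forall>z w. F i z w = (b * z - a * w) * \<psi> z w)"
      using binary_form_factor_root[of "Suc d" _ a b] ab Suc.prems(1) by (force simp: form_tuple_def)
    then obtain F' where F': "\<And>i. i < m \<Longrightarrow> binary_form d (F' i)"
        "\<And>i z w. i < m \<Longrightarrow> F i z w = (b * z - a * w) * F' i z w"
      by metis
    have "form_tuple m d F'" using F' by (simp add: form_tuple_def)
    moreover have "\<exists>i<m. \<exists>z w. F' i z w \<noteq> 0" using Suc.prems(2) F' by fastforce
    ultimately obtain e G K where G: "form_tuple m e G" "base_point_free m G"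
        "\<And>i z w. i < m \<Longrightarrow> F' i z w = K z w * G i z w"
      using Suc.IH by blast
    then show ?thesis using F'(2)
      by (intro exI[of _ e] exI[of _ G] exI[of _ "\<lambda>z w. (b * z - a * w) * K z w"])
         (auto simp: mult.assoc)
  qed
qed

text \<open>The hypothesis says that \<open>u / p\<close> has no pole at any \<open>x\<close>. Roots of \<open>p\<close> are cancelled one
  at a time.\<close>

lemma poly_dvd_if_locally_dvd:
  fixes p u :: "complex poly"
  assumes "p \<noteq> 0" "\<And>x. \<exists>b c. poly c x \<noteq> 0 \<and> p * b = c * u"
  shows "p dvd u"
  using assms
proof (induction "degree p" arbitrary: p u)
  case 0
  then show ?case by (metis is_unit_iff_degree unit_imp_dvd)
next
  case (Suc k)
  then have "\<not> constant (poly p)" by (simp add: constant_degree)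
  then obtain x where x: "poly p x = 0" using fundamental_theorem_of_algebra by blast
  then obtain p' where p': "p = [:-x, 1:] * p'" by (metis dvdE poly_eq_0_iff_dvd)
  have "poly u x = 0" using Suc.prems(2)[of x] x by (metis mult_eq_0_iff poly_mult)
  then obtain u' where u': "u = [:-x, 1:] * u'" by (metis dvdE poly_eq_0_iff_dvd)
  have "p' \<noteq> 0" using p' Suc.prems(1) by auto
  then have "degree p = Suc (degree p')" unfolding p' by (subst degree_mult_eq) auto
  moreover have "\<exists>b c. poly c y \<noteq> 0 \<and> p' * b = c * u'" for y
  proof -
    obtain b c where bc: "poly c y \<noteq> 0" "p * b = c * u" using Suc.prems(2) by blast
    then have "[:-x, 1:] * (p' * b) = [:-x, 1:] * (c * u')"
      unfolding p' u' by (simp only: ac_simps)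
    then have "p' * b = c * u'" by (metis mult_left_cancel pCons_eq_0_iff zero_neq_one)
    then show ?thesis using bc by blast
  qed
  ultimately have "p' dvd u'" using Suc.hyps \<open>p' \<noteq> 0\<close> by simp
  then show ?case unfolding p' u' by (rule mult_dvd_mono[OF dvd_refl])
qed

text \<open>The quotient \<open>G / F\<close> is a rational function that may be computed in any coordinate. At each
  point some \<open>F i\<close> does not vanish, so the quotient has no pole, and some \<open>G j\<close> does not vanish, so it
  has no zero: it is a constant. The degree of a tuple without base points can be read off at \<open>[1:0]\<close>, so
  the degrees agree as well.\<close>

lemma proportional_tuples:
  assumes F: "form_tuple m d F" "base_point_free m F"
    and G: "form_tuple m e G" "base_point_free m G"
    and generic: "\<forall>\<^sub>F z in cofinite. \<forall>i<m. \<forall>j<m. F i z 1 * G j z 1 = F j z 1 * G i z 1"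
  shows "d = e \<and> (\<exists>c. c \<noteq> 0 \<and> (\<forall>i<m. \<forall>z w. G i z w = c * F i z w))"
proof -
  obtain p where p: "\<And>i. i < m \<Longrightarrow> degree (p i) \<le> d" "\<And>i. i < m \<Longrightarrow> F i = homogenize d (p i)"
    using F(1) unfolding form_tuple_def binary_form_def by metis
  obtain q where q: "\<And>i. i < m \<Longrightarrow> degree (q i) \<le> e" "\<And>i. i < m \<Longrightarrow> G i = homogenize e (q i)"
    using G(1) unfolding form_tuple_def binary_form_def by metis
  have pnz: "\<exists>i<m. poly (p i) x \<noteq> 0" for x
    using F(2) p homogenize_one unfolding base_point_free_def by (metis zero_neq_one)
  have qnz: "\<exists>i<m. poly (q i) x \<noteq> 0" for x
    using G(2) q homogenize_one unfolding base_point_free_def by (metis zero_neq_one)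
  have cross: "p i * q j = p j * q i" if ij: "i < m" "j < m" for i j
  proof -
    have "\<forall>\<^sub>F z in cofinite. F i z 1 * G j z 1 = F j z 1 * G i z 1"
      using generic by eventually_elim (use ij in blast)
    then have "F i z 1 * G j z 1 = F j z 1 * G i z 1" for z
      using binary_form_eq[of "d + e" "\<lambda>z w. F i z w * G j z w" "\<lambda>z w. F j z w * G i z w" z 1]
        F(1) G(1) ij by (simp add: form_tuple_def binary_form_mult)
    then show ?thesis using p q ij
      by (simp add: homogenize_one poly_eq_poly_eq_iff[symmetric] fun_eq_iff)
  qed
  obtain i0 where i0: "i0 < m" "p i0 \<noteq> 0" using pnz[of 0] by (metis poly_0)
  have "p i0 dvd q i0"
    using i0 pnz cross by (intro poly_dvd_if_locally_dvd) (auto, metis)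
  then obtain k where k: "q i0 = p i0 * k" by (rule dvdE)
  \<comment> \<open>The quotient k does not depend on the coordinate, and a zero of k would be a base point of G.\<close>
  have qk: "q j = p j * k" if j: "j < m" for j
  proof -
    have "p i0 * q j = p i0 * (p j * k)" using cross[OF i0(1) j] k by (simp add: ac_simps)
    then show ?thesis using i0 by simp
  qed
  have "poly k x \<noteq> 0" for x using qnz[of x] qk by auto
  then have "constant (poly k)" using fundamental_theorem_of_algebra by blast
  then obtain c where c: "k = [:c:]" by (metis constant_degree degree_eq_zeroE)
  then have "c \<noteq> 0" using \<open>\<And>x. poly k x \<noteq> 0\<close> by auto
  have qc: "q j = smult c (p j)" if "j < m" for j using qk[OF that] c by simp
  obtain i where i: "i < m" "coeff (p i) d \<noteq> 0"
    using F(2) p unfolding base_point_free_def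
    by (metis homogenize_at_infinity mult_eq_0_iff zero_neq_one)
  obtain j where j: "j < m" "coeff (q j) e \<noteq> 0"
    using G(2) q unfolding base_point_free_def
    by (metis homogenize_at_infinity mult_eq_0_iff zero_neq_one)
  have "d \<le> e" using i qc q(1)[of i] \<open>c \<noteq> 0\<close> le_degree[of "q i" d] by simp
  moreover have "e \<le> d" using j qc p(1)[of j] \<open>c \<noteq> 0\<close> le_degree[of "p j" e] by simp
  ultimately have "d = e" by simp
  moreover have "G i z w = c * F i z w" if "i < m" for i z w
    using that p q qc \<open>d = e\<close> by (simp add: homogenize_def sum_distrib_left mult.assoc)
  ultimately show ?thesis using \<open>c \<noteq> 0\<close> by blast
qed

section \<open>Points given by forms\<close>

lemma poly_eval_form_tuple:
  assumes p: "p \<in> homog n e" and F: "form_tuple (Suc n) d F"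
  shows "binary_form (e * d) (\<lambda>z w. poly_eval p (vec (Suc n) (\<lambda>i. F i z w)))"
  unfolding poly_eval_def
proof (intro binary_form_sum binary_form_scale)
  fix m assume m: "m \<in> Poly_Mapping.keys p"
  let ?k = "Poly_Mapping.keys m" and ?l = "Poly_Mapping.lookup m"
  have k: "?k \<subseteq> {..n}" "(\<Sum>i\<in>?k. ?l i) = e" using p m by (auto simp: homog_def)
  have "binary_form (\<Sum>i\<in>?k. d * ?l i) (\<lambda>z w. \<Prod>i\<in>?k. F i z w ^ ?l i)"
    using F k by (intro binary_form_prod binary_form_power) (auto simp: form_tuple_def)
  moreover have "(\<Sum>i\<in>?k. d * ?l i) = e * d"
    using k(2) by (simp add: sum_distrib_left[symmetric])
  moreover have "(\<Prod>i\<in>?k. F i z w ^ ?l i) = (\<Prod>i\<in>?k. vec (Suc n) (\<lambda>i. F i z w) $ i ^ ?l i)" for z w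
    using k by (intro prod.cong) auto
  ultimately show "binary_form (e * d) (\<lambda>z w. \<Prod>i\<in>?k. vec (Suc n) (\<lambda>i. F i z w) $ i ^ ?l i)"
    by simp
qed

definition tuple_point :: "nat \<Rightarrow> (nat \<Rightarrow> complex \<Rightarrow> complex \<Rightarrow> complex) \<Rightarrow> complex \<Rightarrow> complex \<Rightarrow> point" where
  "tuple_point m F z w = proj_point (vec m (\<lambda>i. F i z w))"

definition coordinates :: "nat \<Rightarrow> complex \<Rightarrow> complex \<Rightarrow> complex" where
  "coordinates i z w = (if i = 0 then z else w)"

abbreviation line_point :: "complex \<Rightarrow> complex \<Rightarrow> point" where
  "line_point \<equiv> tuple_point 2 coordinates"

lemma self_mem_proj_point: "v \<in> proj_point v"
  unfolding proj_point_def by (rule CollectI, rule exI[of _ 1]) simp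

lemma proj_point_smult: "c \<noteq> 0 \<Longrightarrow> proj_point (c \<cdot>\<^sub>v v) = proj_point v"
proof (intro equalityI subsetI)
  fix x assume c: "c \<noteq> 0"
  show "x \<in> proj_point v" if "x \<in> proj_point (c \<cdot>\<^sub>v v)"
    using that c by (force simp: proj_point_def smult_smult_assoc)
  show "x \<in> proj_point (c \<cdot>\<^sub>v v)" if "x \<in> proj_point v"
  proof -
    obtain a where a: "a \<noteq> 0" "x = a \<cdot>\<^sub>v v" using \<open>x \<in> proj_point v\<close> by (auto simp: proj_point_def)
    then have "x = (a / c) \<cdot>\<^sub>v (c \<cdot>\<^sub>v v)" using c by (simp add: smult_smult_assoc)
    then show ?thesis using a c unfolding proj_point_def by (intro CollectI exI[of _ "a / c"]) simp
  qed
qed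

lemma proj_point_eq_iff: "proj_point u = proj_point v \<longleftrightarrow> (\<exists>c. c \<noteq> 0 \<and> u = c \<cdot>\<^sub>v v)"
proof
  assume "proj_point u = proj_point v"
  then have "u \<in> proj_point v" using self_mem_proj_point[of u] by simp
  then show "\<exists>c. c \<noteq> 0 \<and> u = c \<cdot>\<^sub>v v" by (auto simp: proj_point_def)
qed (auto simp: proj_point_smult)

lemma proj_point_eq_iff_cross:
  assumes u: "\<exists>i<m. u i \<noteq> 0" and v: "\<exists>i<m. v i \<noteq> (0::complex)"
  shows "proj_point (vec m u) = proj_point (vec m v) \<longleftrightarrow> (\<forall>i<m. \<forall>j<m. u i * v j = u j * v i)"
proof
  assume "proj_point (vec m u) = proj_point (vec m v)"
  then obtain c where "vec m u = c \<cdot>\<^sub>v vec m v" by (auto simp: proj_point_eq_iff)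
  then have "u i = c * v i" if "i < m" for i
    using that by (metis dim_vec index_smult_vec(1) index_vec)
  then show "\<forall>i<m. \<forall>j<m. u i * v j = u j * v i" by simp
next
  assume cross: "\<forall>i<m. \<forall>j<m. u i * v j = u j * v i"
  obtain k where k: "k < m" "v k \<noteq> 0" using v by blast
  define c where "c = u k / v k"
  have uv: "u i = c * v i" if "i < m" for i
    using cross k that by (simp add: c_def field_simps)
  then have "vec m u = c \<cdot>\<^sub>v vec m v" by (intro eq_vecI) simp_all
  moreover have "c \<noteq> 0" using u uv by fastforce
  ultimately show "proj_point (vec m u) = proj_point (vec m v)"
    by (auto simp: proj_point_eq_iff)
qed

lemma proj_point_mem_CP:
  assumes "\<exists>i\<le>n. u i \<noteq> 0" shows "proj_point (vec (Suc n) u) \<in> CP n"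
proof -
  have "vec (Suc n) u \<noteq> 0\<^sub>v (Suc n)"
    using assms by (metis index_vec index_zero_vec(1) less_Suc_eq_le)
  then show ?thesis unfolding CP_def by auto
qed

lemma tuple_point_mem_CP:
  "base_point_free (Suc n) F \<Longrightarrow> z \<noteq> 0 \<or> w \<noteq> 0 \<Longrightarrow> tuple_point (Suc n) F z w \<in> CP n"
  unfolding tuple_point_def base_point_free_def less_Suc_eq_le by (auto intro: proj_point_mem_CP)

lemma form_tuple_coordinates: "form_tuple 2 1 coordinates"
proof -
  have "binary_form 1 (\<lambda>z w. z)" "binary_form 1 (\<lambda>z w. w)"
    using binary_form_linear[of 1 0] binary_form_linear[of 0 1] by simp_all
  moreover have "coordinates i = (if i = 0 then (\<lambda>z w. z) else (\<lambda>z w. w))" for i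
    by (auto simp: coordinates_def fun_eq_iff)
  ultimately have "binary_form 1 (coordinates i)" for i by simp
  then show ?thesis by (simp add: form_tuple_def)
qed

lemma base_point_free_coordinates: "base_point_free 2 coordinates"
  unfolding base_point_free_def
proof (intro allI impI)
  fix z w :: complex assume "z \<noteq> 0 \<or> w \<noteq> 0"
  then have "coordinates 0 z w \<noteq> 0 \<or> coordinates 1 z w \<noteq> 0" by (simp add: coordinates_def)
  then show "\<exists>i<2. coordinates i z w \<noteq> 0"
    by (metis one_less_numeral_iff pos2 semiring_norm(76))
qed

lemma line_point_mem_CP: "z \<noteq> 0 \<or> w \<noteq> 0 \<Longrightarrow> line_point z w \<in> CP 1"
  using tuple_point_mem_CP[of 1 coordinates z w] base_point_free_coordinates
  by (simp only: Suc_1)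

lemma CP_1_cases:
  assumes "P \<in> CP 1"
  obtains z w where "z \<noteq> 0 \<or> w \<noteq> 0" "P = line_point z w"
proof -
  obtain v where v: "v \<in> carrier_vec 2" "v \<noteq> 0\<^sub>v 2" "P = proj_point v"
    using assms by (auto simp: CP_def numeral_2_eq_2)
  have eq: "v = vec 2 (\<lambda>i. coordinates i (v $ 0) (v $ 1))"
    using v(1) by (auto simp: coordinates_def less_2_cases_iff intro!: eq_vecI)
  have "v $ 0 \<noteq> 0 \<or> v $ 1 \<noteq> 0"
  proof (rule ccontr)
    assume "\<not> ?thesis"
    then have "v = 0\<^sub>v 2" using v(1) by (intro eq_vecI) (auto simp: less_2_cases_iff)
    then show False using v(2) by simp
  qed
  then show thesis using that v(3) eq unfolding tuple_point_def by metis
qed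

text \<open>The complement of \<open>U\<close> is cut out by homogeneous polynomials. One of them does not vanish at the point
  with parameters \<open>z0, w0\<close>; pulled back along \<open>G\<close> it is a nonzero form, which has only finitely many zeros
  at \<open>w = 1\<close>. The openness is only relative to \<open>X\<close>, whence the hypothesis that almost all points
  lie in \<open>X\<close>.\<close>

lemma generic_point_in_open:
  assumes G: "form_tuple (Suc n) d G" and U: "zariski_open_in n X U"
    and X: "\<forall>\<^sub>F z in cofinite. tuple_point (Suc n) G z 1 \<in> X"
    and z0: "tuple_point (Suc n) G z0 w0 \<in> U" "tuple_point (Suc n) G z0 w0 \<in> CP n"
  shows "\<forall>\<^sub>F z in cofinite. tuple_point (Suc n) G z 1 \<in> U"
proof -
  obtain \<F> where \<F>: "\<F> \<subseteq> (\<Union>d. homog n d)"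
      "U = X - {P \<in> CP n. \<forall>p\<in>\<F>. \<forall>v\<in>P. poly_eval p v = 0}"
    using U by (auto simp: zariski_open_in_def zariski_closed_def)
  then obtain p v where p: "p \<in> \<F>" "v \<in> tuple_point (Suc n) G z0 w0" "poly_eval p v \<noteq> 0"
    using z0 by blast
  then obtain e where e: "p \<in> homog n e" using \<F> by blast
  obtain c where c: "c \<noteq> 0" "v = c \<cdot>\<^sub>v vec (Suc n) (\<lambda>i. G i z0 w0)"
    using p(2) by (auto simp: tuple_point_def proj_point_def)
  define N where "N z w = poly_eval p (vec (Suc n) (\<lambda>i. c * G i z w))" for z w
  have smult: "vec (Suc n) (\<lambda>i. c * G i z w) = c \<cdot>\<^sub>v vec (Suc n) (\<lambda>i. G i z w)" for z w
    by (auto intro!: eq_vecI)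
  have "form_tuple (Suc n) d (\<lambda>i z w. c * G i z w)"
    using G by (auto simp: form_tuple_def intro: binary_form_scale)
  then have "binary_form (e * d) N"
    unfolding N_def by (intro poly_eval_form_tuple e) auto
  moreover have "N z0 w0 \<noteq> 0" using p(3) c(2) by (simp add: N_def smult)
  ultimately have "\<forall>\<^sub>F z in cofinite. N z 1 \<noteq> 0" by (rule binary_form_generic_nonzero)
  then show ?thesis using X
  proof eventually_elim
    case (elim z)
    have "c \<cdot>\<^sub>v vec (Suc n) (\<lambda>i. G i z 1) \<in> tuple_point (Suc n) G z 1"
      using c by (auto simp: tuple_point_def proj_point_def)
    then show ?case using elim p(1) by (auto simp: \<F>(2) N_def smult)
  qed
qed

text \<open>Two tuples that define the same point almost everywhere satisfy the proportionality equations
  identically, also where one of them vanishes.\<close>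

lemma cross_identity:
  assumes F: "form_tuple m d F" and G: "form_tuple m e G"
    and generic: "\<forall>\<^sub>F z in cofinite. (\<exists>i<m. F i z 1 \<noteq> 0) \<and> (\<exists>i<m. G i z 1 \<noteq> 0) \<and>
      tuple_point m F z 1 = tuple_point m G z 1"
    and ij: "i < m" "j < m"
  shows "F i z w * G j z w = F j z w * G i z w"
proof (rule binary_form_eq[of "d + e" "\<lambda>z w. F i z w * G j z w" "\<lambda>z w. F j z w * G i z w"])
  show "\<forall>\<^sub>F z in cofinite. F i z 1 * G j z 1 = F j z 1 * G i z 1"
    using generic
  proof eventually_elim
    case (elim z)
    then have "\<forall>i<m. \<forall>j<m. F i z 1 * G j z 1 = F j z 1 * G i z 1"
      using proj_point_eq_iff_cross[of m "\<lambda>i. F i z 1" "\<lambda>i. G i z 1"]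
      unfolding tuple_point_def by blast
    then show ?case using ij by blast
  qed
  show "binary_form (d + e) (\<lambda>z w. F i z w * G j z w)"
    by (rule binary_form_mult) (use F G ij in \<open>simp_all add: form_tuple_def\<close>)
  show "binary_form (d + e) (\<lambda>z w. F j z w * G i z w)"
    by (rule binary_form_mult) (use F G ij in \<open>simp_all add: form_tuple_def\<close>)
qed

lemma regular_map_local_forms:
  assumes f: "regular_map 1 (CP 1) n Y f" and ab: "a \<noteq> 0 \<or> b \<noteq> 0"
  shows "\<exists>d F. form_tuple (Suc n) d F \<and> (\<exists>i<Suc n. F i a b \<noteq> 0) \<and>
    f (line_point a b) = tuple_point (Suc n) F a b \<and>
    (\<forall>\<^sub>F z in cofinite. (\<exists>i<Suc n. F i z 1 \<noteq> 0) \<and> f (line_point z 1) = tuple_point (Suc n) F z 1)"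
proof -
  obtain U d P where U: "zariski_open_in 1 (CP 1) U" "line_point a b \<in> U"
    and P: "\<forall>i\<le>n. P i \<in> homog 1 d"
    and f: "\<forall>Q\<in>U. \<forall>v\<in>Q. (\<exists>i\<le>n. poly_eval (P i) v \<noteq> 0) \<and>
           f Q = proj_point (vec (Suc n) (\<lambda>i. poly_eval (P i) v))"
    using conjunct2[OF f[unfolded regular_map_def], rule_format, OF line_point_mem_CP[OF ab]]
    by (elim exE conjE) (rule that)
  define F where "F i z w = poly_eval (P i) (vec 2 (\<lambda>i. coordinates i z w))" for i z w
  have F: "form_tuple (Suc n) d F"
    using poly_eval_form_tuple[of _ 1 d 1 coordinates] P form_tuple_coordinates
    by (simp add: form_tuple_def F_def[abs_def] Suc_1 less_Suc_eq_le del: One_nat_def)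
  have on_U: "(\<exists>i<Suc n. F i z w \<noteq> 0) \<and> f (line_point z w) = tuple_point (Suc n) F z w"
    if "line_point z w \<in> U" for z w
  proof -
    have "vec 2 (\<lambda>i. coordinates i z w) \<in> line_point z w"
      by (simp add: tuple_point_def self_mem_proj_point)
    then show ?thesis using f that unfolding tuple_point_def F_def less_Suc_eq_le by blast
  qed
  have "\<forall>\<^sub>F z in cofinite. line_point z 1 \<in> U"
    using generic_point_in_open[of 1 1 coordinates "CP 1" U a b] form_tuple_coordinates U
      line_point_mem_CP ab by (simp only: Suc_1) simp
  then have "\<forall>\<^sub>F z in cofinite. (\<exists>i<Suc n. F i z 1 \<noteq> 0) \<and> f (line_point z 1) = tuple_point (Suc n) F z 1"
    by eventually_elim (use on_U in blast)
  with F on_U[OF U(2)] show ?thesis by blast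
qed

lemma tuple_point_cancel:
  assumes "\<forall>i<m. F i z w = k * G i z w" "\<exists>i<m. F i z w \<noteq> 0"
  shows "tuple_point m F z w = tuple_point m G z w" "k \<noteq> 0"
proof -
  have "vec m (\<lambda>i. F i z w) = k \<cdot>\<^sub>v vec m (\<lambda>i. G i z w)" using assms(1) by (auto intro!: eq_vecI)
  moreover show "k \<noteq> 0" using assms by auto
  ultimately show "tuple_point m F z w = tuple_point m G z w"
    by (simp add: tuple_point_def proj_point_smult)
qed

text \<open>Once the common factors of one local representation are removed, it represents the map
  everywhere: near any other point it agrees with the local representation there at almost all points,
  so the cross products agree identically, and neither tuple vanishes at that point.\<close>

lemma regular_map_global_forms:
  assumes f: "regular_map 1 (CP 1) n Y f"
  shows "\<exists>d F. form_tuple (Suc n) d F \<and> base_point_free (Suc n) F \<and>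
    (\<forall>z w. z \<noteq> 0 \<or> w \<noteq> 0 \<longrightarrow> f (line_point z w) = tuple_point (Suc n) F z w)"
proof -
  obtain d' F' where F': "form_tuple (Suc n) d' F'" "\<exists>i<Suc n. F' i 1 0 \<noteq> 0"
    and gen': "\<forall>\<^sub>F z in cofinite. (\<exists>i<Suc n. F' i z 1 \<noteq> 0) \<and> f (line_point z 1) = tuple_point (Suc n) F' z 1"
    using regular_map_local_forms[OF f, of 1 0] by auto
  then obtain d F K where F: "form_tuple (Suc n) d F" "base_point_free (Suc n) F"
    "\<And>i z w. i < Suc n \<Longrightarrow> F' i z w = K z w * F i z w"
    using remove_base_points[OF F'(1)] by blast
  have F_nz: "\<exists>i<Suc n. F i z w \<noteq> 0" if "z \<noteq> 0 \<or> w \<noteq> 0" for z w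
    using F(2) that by (simp add: base_point_free_def)
  have gen: "\<forall>\<^sub>F z in cofinite. f (line_point z 1) = tuple_point (Suc n) F z 1"
    using gen'
  proof eventually_elim
    case (elim z)
    then have "tuple_point (Suc n) F' z 1 = tuple_point (Suc n) F z 1"
      using F(3) by (intro tuple_point_cancel(1)) auto
    then show ?case using elim by simp
  qed
  have "f (line_point a b) = tuple_point (Suc n) F a b" if ab: "a \<noteq> 0 \<or> b \<noteq> 0" for a b
  proof -
    obtain e G where G: "form_tuple (Suc n) e G" "\<exists>i<Suc n. G i a b \<noteq> 0"
      "f (line_point a b) = tuple_point (Suc n) G a b"
      and genG: "\<forall>\<^sub>F z in cofinite. (\<exists>i<Suc n. G i z 1 \<noteq> 0) \<and> f (line_point z 1) = tuple_point (Suc n) G z 1"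
      using regular_map_local_forms[OF f ab] by blast
    have "\<forall>\<^sub>F z in cofinite. (\<exists>i<Suc n. F i z 1 \<noteq> 0) \<and> (\<exists>i<Suc n. G i z 1 \<noteq> 0) \<and>
      tuple_point (Suc n) F z 1 = tuple_point (Suc n) G z 1"
      using gen genG by eventually_elim (use F_nz in force)
    then have "F i a b * G j a b = F j a b * G i a b" if "i < Suc n" "j < Suc n" for i j
      using cross_identity[OF F(1) G(1)] that by blast
    then have "tuple_point (Suc n) F a b = tuple_point (Suc n) G a b"
      unfolding tuple_point_def using G(2) F_nz[OF ab] by (subst proj_point_eq_iff_cross) blast+
    then show ?thesis using G(3) by simp
  qed
  with F show ?thesis by (intro exI[of _ d] exI[of _ F] conjI) simp_all
qed

section \<open>Lifting a projective symmetry to the line\<close>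

definition mat_tuple :: "nat \<Rightarrow> complex mat \<Rightarrow> (nat \<Rightarrow> complex \<Rightarrow> complex \<Rightarrow> complex) \<Rightarrow>
    nat \<Rightarrow> complex \<Rightarrow> complex \<Rightarrow> complex" where
  "mat_tuple m A F i z w = (\<Sum>j<m. A $$ (i, j) * F j z w)"

lemma vec_mat_tuple:
  assumes "A \<in> carrier_mat m m"
  shows "vec m (\<lambda>i. mat_tuple m A F i z w) = A *\<^sub>v vec m (\<lambda>i. F i z w)"
  using assms by (intro eq_vecI) (auto simp: mat_tuple_def scalar_prod_def lessThan_atLeast0)

lemma form_tuple_mat_tuple: "form_tuple m d F \<Longrightarrow> form_tuple m d (mat_tuple m A F)"
  unfolding form_tuple_def mat_tuple_def[abs_def]
  by (auto intro!: binary_form_sum binary_form_scale)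

lemma GL_inverse:
  assumes "A \<in> carrier (GL m)"
  obtains B where "B \<in> carrier (GL m)" "A * B = 1\<^sub>m m" "B * A = 1\<^sub>m m"
proof -
  interpret group "GL m" by (rule group_GL)
  show thesis
    using that[of "inv\<^bsub>GL m\<^esub> A"] assms r_inv[of A] l_inv[of A] inv_closed[of A]
    by (simp add: GL_mult GL_one)
qed

lemma GL_mult_vec_eq_0:
  assumes A: "A \<in> carrier (GL m)" and v: "v \<in> carrier_vec m" and "A *\<^sub>v v = 0\<^sub>v m"
  shows "v = 0\<^sub>v m"
proof -
  obtain B where B: "B \<in> carrier (GL m)" "B * A = 1\<^sub>m m" using GL_inverse[OF A] by blast
  have "v = B * A *\<^sub>v v" using B v by simp
  also have "\<dots> = B *\<^sub>v (A *\<^sub>v v)"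
    using A B v by (intro assoc_mult_mat_vec) (auto dest: GL_carrier_mat)
  finally show ?thesis using assms B by (auto dest!: GL_carrier_mat)
qed

lemma base_point_free_mat_tuple:
  assumes A: "A \<in> carrier (GL m)" and F: "base_point_free m F"
  shows "base_point_free m (mat_tuple m A F)"
  unfolding base_point_free_def
proof (intro allI impI, rule ccontr)
  fix z w :: complex assume zw: "z \<noteq> 0 \<or> w \<noteq> 0" and "\<not> (\<exists>i<m. mat_tuple m A F i z w \<noteq> 0)"
  then have "vec m (\<lambda>i. mat_tuple m A F i z w) = 0\<^sub>v m" by (intro eq_vecI) auto
  then have "A *\<^sub>v vec m (\<lambda>i. F i z w) = 0\<^sub>v m"
    by (simp only: vec_mat_tuple[OF GL_carrier_mat[OF A]])
  from GL_mult_vec_eq_0[OF A _ this] have zero: "vec m (\<lambda>i. F i z w) = 0\<^sub>v m" by simp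
  have "F i z w = 0" if "i < m" for i
    using arg_cong[OF zero, of "\<lambda>v. v $ i"] that by simp
  moreover have "\<exists>i<m. F i z w \<noteq> 0" using F zw unfolding base_point_free_def by simp
  ultimately show False by blast
qed

lemma PGL_act_tuple_point:
  assumes "A \<in> carrier (GL m)"
  shows "PGL_act (scalar_mats m #>\<^bsub>GL m\<^esub> A) (tuple_point m F z w) = tuple_point m (mat_tuple m A F) z w"
  using assms by (simp add: tuple_point_def PGL_act_coset vec_mat_tuple GL_carrier_mat)

lemma eventually_cofinite_ex:
  "\<forall>\<^sub>F z in cofinite. P (z::complex) \<Longrightarrow> \<exists>z. P z"
  using infinite_UNIV_char_0[where ?'a = complex] by (cases "\<exists>z. P z") (simp_all add: eventually_cofinite)

text \<open>With \<open>h\<close> the inverse of \<open>f\<close> on an open part \<open>V\<close> of \<open>S\<close>, the lift is \<open>h \<circ> g \<circ> f\<close>. Because \<open>f\<close> and \<open>g\<close> map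
  onto \<open>S\<close>, almost every parameter is sent into \<open>V\<close> by \<open>g \<circ> f\<close>, and even into a smaller open set on which \<open>h\<close> is
  given by two fixed forms.\<close>

lemma lift_generic:
  assumes f: "birational_map 1 (CP 1) n S f" "f ` CP 1 = S"
    and F: "form_tuple (Suc n) d F" "base_point_free (Suc n) F"
      "\<And>z w. z \<noteq> 0 \<or> w \<noteq> 0 \<Longrightarrow> f (line_point z w) = tuple_point (Suc n) F z w"
    and A: "A \<in> carrier (GL (Suc n))" and gS: "PGL_act (scalar_mats (Suc n) #>\<^bsub>GL (Suc n)\<^esub> A) ` S = S"
  shows "\<exists>e M. form_tuple 2 e M \<and> base_point_free 2 M \<and>
    (\<forall>\<^sub>F z in cofinite. tuple_point (Suc n) F (M 0 z 1) (M 1 z 1) =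
       tuple_point (Suc n) (mat_tuple (Suc n) A F) z 1)"
proof -
  let ?g = "PGL_act (scalar_mats (Suc n) #>\<^bsub>GL (Suc n)\<^esub> A)"
  define G where "G = mat_tuple (Suc n) A F"
  have G: "form_tuple (Suc n) d G" "base_point_free (Suc n) G"
    using F A by (simp_all add: G_def form_tuple_mat_tuple base_point_free_mat_tuple)
  have gf: "?g (f (line_point z w)) = tuple_point (Suc n) G z w" if "z \<noteq> 0 \<or> w \<noteq> 0" for z w
    using F(3)[OF that] A by (simp add: PGL_act_tuple_point G_def)
  have G_S: "tuple_point (Suc n) G z w \<in> S" if zw: "z \<noteq> 0 \<or> w \<noteq> 0" for z w
  proof -
    have "?g (f (line_point z w)) \<in> ?g ` S" using f(2) line_point_mem_CP[OF zw] by blast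
    then show ?thesis using gS gf[OF zw] by simp
  qed
  obtain U V h where UV: "zariski_open_in 1 (CP 1) U" "zariski_open_in n S V" "V \<noteq> {}"
    and h: "regular_map n V 1 U h" "\<forall>Q\<in>V. f (h Q) = Q"
    using f(1) unfolding birational_map_def biregular_map_def by (elim exE conjE) (rule that)
  \<comment> \<open>The forms that define h near this point are used on an open neighbourhood W of it.\<close>
  obtain Q0 where Q0: "Q0 \<in> V" using UV by blast
  have "V \<subseteq> S" using UV(2) unfolding zariski_open_in_def by blast
  then have "Q0 \<in> ?g ` f ` CP 1" using Q0 by (simp only: f(2) gS subsetD)
  then obtain P where P: "P \<in> CP 1" "Q0 = ?g (f P)" by blast
  obtain z0 w0 where zw0: "z0 \<noteq> 0 \<or> w0 \<noteq> 0" "Q0 = tuple_point (Suc n) G z0 w0"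
  proof (rule CP_1_cases[OF P(1)])
    fix z w :: complex assume "z \<noteq> 0 \<or> w \<noteq> 0" "P = line_point z w"
    then show thesis using that[of z w] P(2) gf by simp
  qed
  note Q0_CP = tuple_point_mem_CP[OF G(2) zw0(1)]
  obtain W e H where W: "zariski_open_in n V W" "Q0 \<in> W"
    and H: "\<forall>i\<le>1. H i \<in> homog n e"
    and hW: "\<forall>Q\<in>W. \<forall>v\<in>Q. (\<exists>i\<le>1. poly_eval (H i) v \<noteq> 0) \<and>
           h Q = proj_point (vec (Suc 1) (\<lambda>i. poly_eval (H i) v))"
    using conjunct2[OF h(1)[unfolded regular_map_def], rule_format, OF Q0]
    by (elim exE conjE) (rule that)
  have genV: "\<forall>\<^sub>F z in cofinite. tuple_point (Suc n) G z 1 \<in> V"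
    using generic_point_in_open[OF G(1) UV(2)] G_S Q0 zw0(2) Q0_CP by simp
  then have genW: "\<forall>\<^sub>F z in cofinite. tuple_point (Suc n) G z 1 \<in> W"
    using generic_point_in_open[OF G(1) W(1)] W(2) zw0(2) Q0_CP by simp
  define N where "N i z w = poly_eval (H i) (vec (Suc n) (\<lambda>i. G i z w))" for i z w
  have N: "form_tuple 2 (e * d) N"
    using poly_eval_form_tuple[OF _ G(1)] H
    by (simp add: form_tuple_def N_def[abs_def] less_2_cases_iff)
  have N_on_W: "(\<exists>i<2. N i z 1 \<noteq> 0) \<and> h (tuple_point (Suc n) G z 1) = tuple_point 2 N z 1"
    if "tuple_point (Suc n) G z 1 \<in> W" for z
  proof -
    have "vec (Suc n) (\<lambda>i. G i z 1) \<in> tuple_point (Suc n) G z 1"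
      by (simp add: tuple_point_def self_mem_proj_point)
    then have "(\<exists>i\<le>1. N i z 1 \<noteq> 0) \<and> h (tuple_point (Suc n) G z 1) = tuple_point (Suc 1) N z 1"
      using hW that unfolding N_def tuple_point_def[of "Suc 1"] by blast
    then show ?thesis by (simp add: Suc_1[symmetric] less_Suc_eq_le del: Suc_1 One_nat_def)
  qed
  have "\<exists>i<2. \<exists>z w. N i z w \<noteq> 0"
    using eventually_cofinite_ex[OF genW] N_on_W by blast
  then obtain e' M K where M: "form_tuple 2 e' M" "base_point_free 2 M"
      "\<And>i z w. i < 2 \<Longrightarrow> N i z w = K z w * M i z w"
    using remove_base_points[OF N] by blast
  have M_vec: "tuple_point 2 M z w = line_point (M 0 z w) (M 1 z w)" for z w
    unfolding tuple_point_def
    by (rule arg_cong[of _ _ proj_point], rule eq_vecI) (auto simp: coordinates_def less_2_cases_iff)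
  have "\<forall>\<^sub>F z in cofinite. tuple_point (Suc n) F (M 0 z 1) (M 1 z 1) = tuple_point (Suc n) G z 1"
    using genV genW
  proof eventually_elim
    case (elim z)
    have "tuple_point 2 N z 1 = tuple_point 2 M z 1"
      using N_on_W elim M(3) by (intro tuple_point_cancel(1)) auto
    then have "h (tuple_point (Suc n) G z 1) = line_point (M 0 z 1) (M 1 z 1)"
      using N_on_W elim M_vec by simp
    then have "f (line_point (M 0 z 1) (M 1 z 1)) = tuple_point (Suc n) G z 1"
      using h(2)[rule_format, OF elim(1)] by simp
    moreover have "M 0 z 1 \<noteq> 0 \<or> M 1 z 1 \<noteq> 0"
    proof -
      have "\<exists>i<2. M i z 1 \<noteq> 0" using M(2) unfolding base_point_free_def by simp
      then show ?thesis by (auto simp: less_2_cases_iff)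
    qed
    ultimately show ?case using F(3) by simp
  qed
  then show ?thesis using M unfolding G_def by blast
qed

lemma form_tuple_compose:
  assumes "form_tuple m d F" "form_tuple 2 e M"
  shows "form_tuple m (d * e) (\<lambda>i z w. F i (M 0 z w) (M 1 z w))"
  using assms binary_form_compose[of d _ e "M 0" "M 1"] by (auto simp: form_tuple_def)

lemma base_point_free_compose:
  assumes "base_point_free m F" "base_point_free 2 M"
  shows "base_point_free m (\<lambda>i z w. F i (M 0 z w) (M 1 z w))"
  unfolding base_point_free_def
proof (intro allI impI)
  fix z w :: complex assume "z \<noteq> 0 \<or> w \<noteq> 0"
  then have "\<exists>i<2. M i z w \<noteq> 0" using assms(2) by (simp add: base_point_free_def)
  then have "M 0 z w \<noteq> 0 \<or> M 1 z w \<noteq> 0" by (auto simp: less_2_cases_iff)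
  then show "\<exists>i<m. F i (M 0 z w) (M 1 z w) \<noteq> 0" using assms(1) by (simp add: base_point_free_def)
qed

text \<open>The degree argument: \<open>F\<close> composed with the lift has degree \<open>d * e\<close> and is proportional to the
  transformed tuple of degree \<open>d\<close>, so \<open>e = 1\<close>. A linear lift without base points is invertible.\<close>

lemma lift_linear:
  assumes f: "birational_map 1 (CP 1) n S f" "f ` CP 1 = S"
    and F: "form_tuple (Suc n) d F" "base_point_free (Suc n) F" "d > 0"
      "\<And>z w. z \<noteq> 0 \<or> w \<noteq> 0 \<Longrightarrow> f (line_point z w) = tuple_point (Suc n) F z w"
    and A: "A \<in> carrier (GL (Suc n))" and gS: "PGL_act (scalar_mats (Suc n) #>\<^bsub>GL (Suc n)\<^esub> A) ` S = S"
  shows "\<exists>a b a' b' c. a * b' \<noteq> a' * b \<and> c \<noteq> 0 \<and>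
    (\<forall>i<Suc n. \<forall>z w. mat_tuple (Suc n) A F i z w = c * F i (a * z + b * w) (a' * z + b' * w))"
proof -
  obtain e M where M: "form_tuple 2 e M" "base_point_free 2 M"
    and gen: "\<forall>\<^sub>F z in cofinite. tuple_point (Suc n) F (M 0 z 1) (M 1 z 1) =
       tuple_point (Suc n) (mat_tuple (Suc n) A F) z 1"
    using lift_generic[OF f F(1,2,4) A gS] by blast
  define G where "G = mat_tuple (Suc n) A F"
  define FM where "FM i z w = F i (M 0 z w) (M 1 z w)" for i z w
  have G: "form_tuple (Suc n) d G" "base_point_free (Suc n) G"
    using F A by (simp_all add: G_def form_tuple_mat_tuple base_point_free_mat_tuple)
  have FM: "form_tuple (Suc n) (d * e) FM" "base_point_free (Suc n) FM"
    unfolding FM_def[abs_def]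
    by (intro form_tuple_compose base_point_free_compose F M)+
  have "\<forall>\<^sub>F z in cofinite. \<forall>i<Suc n. \<forall>j<Suc n. FM i z 1 * G j z 1 = FM j z 1 * G i z 1"
    using gen
  proof eventually_elim
    case (elim z)
    have "\<exists>i<Suc n. FM i z 1 \<noteq> 0" "\<exists>i<Suc n. G i z 1 \<noteq> 0"
      using FM(2) G(2) unfolding base_point_free_def by simp_all
    then show ?case
      using elim proj_point_eq_iff_cross[of "Suc n" "\<lambda>i. FM i z 1" "\<lambda>i. G i z 1"]
      unfolding tuple_point_def FM_def G_def by blast
  qed
  from proportional_tuples[OF FM G this]
  obtain c where c: "d * e = d" "c \<noteq> 0" "\<And>i z w. i < Suc n \<Longrightarrow> G i z w = c * FM i z w"
    by blast
  then have "e = 1" using F(3) by simp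
  have linear: "\<exists>a b. \<forall>z w. M i z w = a * z + b * w" if "i < 2" for i
  proof -
    have "binary_form 1 (M i)" using M(1) \<open>e = 1\<close> that by (simp add: form_tuple_def)
    then obtain q where "M i = homogenize 1 q" by (auto simp: binary_form_def)
    then have "M i z w = coeff q 1 * z + coeff q 0 * w" for z w by (simp add: homogenize_def)
    then show ?thesis by blast
  qed
  obtain a b where ab: "\<And>z w. M 0 z w = a * z + b * w" using linear[of 0] by auto
  obtain a' b' where ab': "\<And>z w. M 1 z w = a' * z + b' * w" using linear[of 1] by auto
  have "a * b' \<noteq> a' * b"
  proof
    assume det: "a * b' = a' * b"
    have ker: "a * z + b * w \<noteq> 0 \<or> a' * z + b' * w \<noteq> 0" if "z \<noteq> 0 \<or> w \<noteq> 0" for z w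
    proof -
      have "\<exists>i<2. M i z w \<noteq> 0" using M(2) that unfolding base_point_free_def by simp
      then have "M 0 z w \<noteq> 0 \<or> M 1 z w \<noteq> 0" by (auto simp: less_2_cases_iff)
      then show ?thesis unfolding ab ab' .
    qed
    \<comment> \<open>If the determinant is 0, both forms vanish at [b:-a] and at [b':-a'].\<close>
    have "b = 0 \<and> a = 0" using ker[of b "-a"] det by (auto simp: algebra_simps)
    moreover have "b' = 0 \<and> a' = 0" using ker[of b' "-a'"] det by (auto simp: algebra_simps)
    ultimately show False using ker[of 1 0] by simp
  qed
  moreover have "\<forall>i<Suc n. \<forall>z w. mat_tuple (Suc n) A F i z w = c * F i (a * z + b * w) (a' * z + b' * w)"
    using c(3) unfolding FM_def G_def ab ab' by blast
  ultimately show ?thesis using c(2) by blast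
qed

section \<open>Linear algebra: normal forms and bases\<close>

lemma ex_kernel_2x2:
  fixes a :: complex
  assumes "a * b' = a' * b"
  shows "\<exists>x y. (x \<noteq> 0 \<or> y \<noteq> 0) \<and> a * x + b * y = 0 \<and> a' * x + b' * y = 0"
proof (cases "a = 0 \<and> b = 0")
  case True
  show ?thesis
  proof (cases "a' = 0 \<and> b' = 0")
    case True
    then show ?thesis using \<open>a = 0 \<and> b = 0\<close> by (intro exI[of _ 1]) simp
  next
    case False
    then show ?thesis using True by (intro exI[of _ b'] exI[of _ "- a'"]) auto
  qed
next
  case False
  then show ?thesis using assms by (intro exI[of _ b] exI[of _ "- a"]) (auto simp: algebra_simps)
qed

text \<open>Jordan form of an invertible \<open>2 \<times> 2\<close> matrix. The columns \<open>(p, p')\<close> and \<open>(q, q')\<close> are the new basis; the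
  off-diagonal entry \<open>e\<close> of a Jordan block is scaled to be the eigenvalue \<open>l\<close> instead of \<open>1\<close>, so
  that the block becomes \<open>l\<close> times the substitution \<open>z \<mapsto> z + w\<close>.\<close>

lemma normal_form_2x2:
  fixes a b a' b' :: complex
  assumes det: "a * b' \<noteq> a' * b"
  shows "\<exists>p q p' q' l m e. p * q' \<noteq> p' * q \<and> l \<noteq> 0 \<and> m \<noteq> 0 \<and> (e = 0 \<or> e = l \<and> m = l) \<and>
    a * p + b * p' = l * p \<and> a' * p + b' * p' = l * p' \<and>
    a * q + b * q' = m * q + e * p \<and> a' * q + b' * q' = m * q' + e * p'"
proof -
  \<comment> \<open>The characteristic polynomial; m is its second root.\<close>
  define P where "P = [:a * b' - a' * b, - (a + b'), 1:]"
  have "degree P = 2" by (simp add: P_def)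
  then have "\<not> constant (poly P)" by (simp add: constant_degree)
  then obtain l where "poly P l = 0" using fundamental_theorem_of_algebra by blast
  then have l: "(a - l) * (b' - l) = a' * b" by (simp add: P_def algebra_simps)
  define m where "m = a + b' - l"
  have m: "(a - m) * (b' - m) = a' * b" and lm: "l * m = a * b' - a' * b"
    using l by (auto simp: m_def algebra_simps)
  have nz: "l \<noteq> 0" "m \<noteq> 0" using lm det by auto
  show ?thesis
  proof (cases "l = m")
    case False
    obtain p p' where p: "p \<noteq> 0 \<or> p' \<noteq> 0" "(a - l) * p + b * p' = 0" "a' * p + (b' - l) * p' = 0"
      using ex_kernel_2x2[OF l] by blast
    obtain q q' where q: "q \<noteq> 0 \<or> q' \<noteq> 0" "(a - m) * q + b * q' = 0" "a' * q + (b' - m) * q' = 0"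
      using ex_kernel_2x2[OF m] by blast
    have "p * q' \<noteq> p' * q"
    proof
      assume dep: "p * q' = p' * q"
      have "(l - m) * (p * q) = q * ((a - m) * p + b * p') - q * ((a - l) * p + b * p')"
        by (simp add: algebra_simps)
      also have "\<dots> = (a - m) * p * q + b * (p' * q)" unfolding p(2) by (simp add: algebra_simps)
      also have "\<dots> = p * ((a - m) * q + b * q')"
        unfolding dep[symmetric] by (simp add: algebra_simps)
      finally have pq: "p * q = 0" using q(2) False by simp
      have "(l - m) * (p' * q') = q' * (a' * p + (b' - m) * p') - q' * (a' * p + (b' - l) * p')"
        by (simp add: algebra_simps)
      also have "\<dots> = a' * (p * q') + (b' - m) * p' * q'" unfolding p(3) by (simp add: algebra_simps)
      also have "\<dots> = p' * (a' * q + (b' - m) * q')" unfolding dep by (simp add: algebra_simps)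
      finally have "p' * q' = 0" using q(3) False by simp
      then show False using pq dep p(1) q(1) by auto
    qed
    moreover have "a * p + b * p' = ((a - l) * p + b * p') + l * p"
      "a' * p + b' * p' = (a' * p + (b' - l) * p') + l * p'"
      "a * q + b * q' = ((a - m) * q + b * q') + m * q"
      "a' * q + b' * q' = (a' * q + (b' - m) * q') + m * q'"
      by (simp_all add: algebra_simps)
    then have "a * p + b * p' = l * p" "a' * p + b' * p' = l * p'"
      "a * q + b * q' = m * q + 0 * p" "a' * q + b' * q' = m * q' + 0 * p'"
      unfolding p(2,3) q(2,3) by simp_all
    ultimately show ?thesis using nz by blast
  next
    case True
    then have tr: "b' = 2 * l - a" by (simp add: m_def algebra_simps)
    have nil: "(a - l) * (a - l) + a' * b = 0" using l by (simp add: tr algebra_simps)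
    consider "a' \<noteq> 0" | "b \<noteq> 0" | "a' = 0" "b = 0" by blast
    then show ?thesis
    proof cases
      case 1
      \<comment> \<open>The first unit vector is not an eigenvector: it is the second basis vector here.\<close>
      define p p' where "p = (a - l) / l" and "p' = a' / l"
      have lp: "l * p = a - l" "l * p' = a'" using nz by (simp_all add: p_def p'_def)
      have "l * (a * p + b * p') = a * (l * p) + b * (l * p')" by (simp add: algebra_simps)
      also have "\<dots> = ((a - l) * (a - l) + a' * b) + l * (a - l)"
        unfolding lp by (simp add: algebra_simps)
      finally have 1: "a * p + b * p' = l * p" unfolding nil lp using nz by simp
      have "l * (a' * p + b' * p') = a' * (l * p) + b' * (l * p')" by (simp add: algebra_simps)
      also have "\<dots> = l * a'" unfolding lp tr by (simp add: algebra_simps)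
      finally have 2: "a' * p + b' * p' = l * p'" unfolding lp using nz by simp
      have "a * 1 + b * 0 = l * 1 + l * p" "a' * 1 + b' * 0 = l * 0 + l * p'"
        unfolding lp by simp_all
      moreover have "p * 0 \<noteq> p' * 1" using \<open>a' \<noteq> 0\<close> nz by (simp add: p'_def)
      ultimately show ?thesis using nz(1) 1 2 by blast
    next
      case 2
      \<comment> \<open>Now the second unit vector plays this part.\<close>
      define p p' where "p = b / l" and "p' = (b' - l) / l"
      have lp: "l * p = b" "l * p' = b' - l" using nz by (simp_all add: p_def p'_def)
      have "l * (a * p + b * p') = a * (l * p) + b * (l * p')" by (simp add: algebra_simps)
      also have "\<dots> = l * b" unfolding lp tr by (simp add: algebra_simps)
      finally have 1: "a * p + b * p' = l * p" unfolding lp using nz by simp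
      have "l * (a' * p + b' * p') = a' * (l * p) + b' * (l * p')" by (simp add: algebra_simps)
      also have "\<dots> = ((a - l) * (a - l) + a' * b) + l * (b' - l)"
        unfolding lp tr by (simp add: algebra_simps)
      finally have 2: "a' * p + b' * p' = l * p'" unfolding nil lp using nz by simp
      have "a * 0 + b * 1 = l * 0 + l * p" "a' * 0 + b' * 1 = l * 1 + l * p'"
        unfolding lp by simp_all
      moreover have "p * 1 \<noteq> p' * 0" using \<open>b \<noteq> 0\<close> nz by (simp add: p_def)
      ultimately show ?thesis using nz(1) 1 2 by blast
    next
      case 3
      have "(1::complex) * 1 \<noteq> 0 * 0" "a * 1 + b * 0 = a * 1" "a' * 1 + b' * 0 = a * 0"
        "a * 0 + b * 1 = b' * 0 + 0 * 1" "a' * 0 + b' * 1 = b' * 1 + 0 * 0" "a \<noteq> 0" "b' \<noteq> 0"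
        using 3 det by simp_all
      then show ?thesis by blast
    qed
  qed
qed

text \<open>A family of vectors of length \<open>m\<close> indexed by \<open>K\<close> is written as a function of two arguments, the index of the
  vector and the position of the entry.\<close>

definition independent_on :: "nat \<Rightarrow> nat set \<Rightarrow> (nat \<Rightarrow> nat \<Rightarrow> complex) \<Rightarrow> bool" where
  "independent_on m K u \<longleftrightarrow>
     (\<forall>x. (\<forall>i<m. (\<Sum>k\<in>K. x k * u k i) = 0) \<longrightarrow> (\<forall>k\<in>K. x k = 0))"

text \<open>Applying a polynomial \<open>p\<close> in \<open>A\<close> to a linear relation multiplies its \<open>k\<close>-th coefficient by \<open>p(\<nu> k)\<close>;
  choosing \<open>p\<close> with roots at all other eigenvalues isolates one term.\<close>

lemma eigenvectors_independent:
  assumes K: "finite K"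
    and eig: "\<And>k i. k \<in> K \<Longrightarrow> i < m \<Longrightarrow> (\<Sum>j<m. A $$ (i, j) * u k j) = \<nu> k * u k i"
    and inj: "inj_on \<nu> K" and nz: "\<And>k. k \<in> K \<Longrightarrow> \<exists>i<m. u k i \<noteq> 0"
  shows "independent_on m K u"
  unfolding independent_on_def
proof (intro allI impI ballI)
  fix x k assume rel: "\<forall>i<m. (\<Sum>k\<in>K. x k * u k i) = 0" and k: "k \<in> K"
  have poly_rel: "\<forall>i<m. (\<Sum>k\<in>K. x k * poly p (\<nu> k) * u k i) = 0" for p
  proof (induction p)
    case 0
    then show ?case by simp
  next
    case (pCons a p)
    show ?case
    proof (intro allI impI)
      fix i assume i: "i < m"
      have "(\<Sum>k\<in>K. x k * poly (pCons a p) (\<nu> k) * u k i) =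
          a * (\<Sum>k\<in>K. x k * u k i) + (\<Sum>k\<in>K. x k * poly p (\<nu> k) * (\<nu> k * u k i))"
        by (simp add: sum_distrib_left sum.distrib algebra_simps)
      also have "\<dots> = (\<Sum>k\<in>K. \<Sum>j<m. A $$ (i, j) * (x k * poly p (\<nu> k) * u k j))"
        using rel i by (simp add: eig[symmetric] sum_distrib_left mult.left_commute cong: sum.cong)
      also have "\<dots> = (\<Sum>j<m. A $$ (i, j) * (\<Sum>k\<in>K. x k * poly p (\<nu> k) * u k j))"
        by (subst sum.swap) (simp add: sum_distrib_left)
      also have "\<dots> = 0" using pCons.IH by simp
      finally show "(\<Sum>k\<in>K. x k * poly (pCons a p) (\<nu> k) * u k i) = 0" .
    qed
  qed
  define p where "p = (\<Prod>l\<in>K - {k}. [:- \<nu> l, 1:])"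
  have p_other: "poly p (\<nu> l) = 0" if "l \<in> K" "l \<noteq> k" for l
    using that K by (auto simp: p_def poly_prod intro!: prod_zero)
  have p_k: "poly p (\<nu> k) \<noteq> 0"
    using K k inj by (auto simp: p_def poly_prod inj_on_eq_iff)
  obtain i where i: "i < m" "u k i \<noteq> 0" using nz[OF k] by blast
  have "0 = (\<Sum>l\<in>K. x l * poly p (\<nu> l) * u l i)" using poly_rel i by simp
  also have "\<dots> = x k * poly p (\<nu> k) * u k i"
    using K k p_other by (subst sum.remove[of _ k]) (auto intro!: sum.neutral)
  finally show "x k = 0" using p_k i by simp
qed

text \<open>Let \<open>s\<close> be the least index in a linear relation. Subtracting the relation from its image under \<open>A / c\<close> gives a
  relation among the later vectors in which \<open>u (Suc s)\<close> has coefficient \<open>(s + 1) * x s\<close>. By induction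
  from the top this coefficient is zero, and hence so is \<open>x s\<close>.\<close>

lemma unipotent_independent:
  assumes act: "\<And>k i. k \<le> d \<Longrightarrow> i < m \<Longrightarrow>
      (\<Sum>j<m. A $$ (i, j) * u k j) = c * (\<Sum>l\<in>{k..d}. of_nat (l choose k) * u l i)"
    and c: "c \<noteq> 0" and top: "\<exists>i<m. u d i \<noteq> 0"
  shows "independent_on m {..d} u"
proof -
  have "\<forall>k\<in>{d - r..d}. x k = 0"
    if "r \<le> d" "\<forall>i<m. (\<Sum>k\<in>{d - r..d}. x k * u k i) = 0" for r x
    using that
  proof (induction r arbitrary: x)
    case 0
    then show ?case using top by auto
  next
    case (Suc r)
    define s where "s = d - Suc r"
    have s: "d - r = Suc s" "s < d" using Suc.prems(1) by (auto simp: s_def)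
    \<comment> \<open>The coefficients of the relation obtained by applying A / c and subtracting the original one.\<close>
    define y where "y l = (\<Sum>k\<in>{s..<l}. x k * of_nat (l choose k))" for l
    have "(\<Sum>l\<in>{Suc s..d}. y l * u l i) = 0" if i: "i < m" for i
    proof -
      have "0 = (\<Sum>j<m. A $$ (i, j) * (\<Sum>k\<in>{s..d}. x k * u k j))"
        using Suc.prems(2) by (simp add: s_def)
      also have "\<dots> = (\<Sum>k\<in>{s..d}. x k * (\<Sum>j<m. A $$ (i, j) * u k j))"
        unfolding sum_distrib_left by (subst sum.swap) (simp add: mult.left_commute)
      also have "\<dots> = c * (\<Sum>k\<in>{s..d}. \<Sum>l\<in>{k..d}. x k * of_nat (l choose k) * u l i)"
        using i by (simp add: act sum_distrib_left mult.assoc mult.left_commute)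
      finally have "0 = (\<Sum>k\<in>{s..d}. \<Sum>l\<in>{k..d}. x k * of_nat (l choose k) * u l i)" using c by simp
      also have "\<dots> = (\<Sum>l\<in>{s..d}. \<Sum>k\<in>{s..l}. x k * of_nat (l choose k) * u l i)"
        unfolding sum.Sigma[OF finite_atLeastAtMost ballI[OF finite_atLeastAtMost]]
        by (rule sum.reindex_bij_witness[of _ "\<lambda>(l, k). (k, l)" "\<lambda>(k, l). (l, k)"]) auto
      also have "\<dots> = (\<Sum>l\<in>{s..d}. y l * u l i + x l * u l i)"
      proof (rule sum.cong[OF refl])
        fix l assume "l \<in> {s..d}"
        then have "{s..l} = insert l {s..<l}" by auto
        then show "(\<Sum>k\<in>{s..l}. x k * of_nat (l choose k) * u l i) = y l * u l i + x l * u l i"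
          by (simp add: y_def sum_distrib_right)
      qed
      also have "\<dots> = (\<Sum>l\<in>{s..d}. y l * u l i)"
        using Suc.prems(2) i by (simp add: sum.distrib s_def)
      also have "\<dots> = y s * u s i + (\<Sum>l\<in>{Suc s..d}. y l * u l i)"
        using s(2) by (simp add: sum.atLeast_Suc_atMost)
      finally show ?thesis by (simp add: y_def)
    qed
    then have "\<forall>l\<in>{Suc s..d}. y l = 0"
      using Suc.IH[of y] Suc.prems(1) s by simp
    then have "y (Suc s) = 0" using s by simp
    then have "x s * of_nat (Suc s) = 0" by (simp add: y_def)
    then have xs: "x s = 0" by (metis mult_eq_0_iff of_nat_neq_0)
    have "(\<Sum>k\<in>{Suc s..d}. x k * u k i) = 0" if "i < m" for i
    proof -
      have "(\<Sum>k\<in>{s..d}. x k * u k i) = 0" using Suc.prems(2) that by (simp add: s_def)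
      then show ?thesis using s(2) xs by (simp add: sum.atLeast_Suc_atMost)
    qed
    then have "\<forall>k\<in>{Suc s..d}. x k = 0" using Suc.IH[of x] Suc.prems(1) s by simp
    then show ?case using xs unfolding s_def[symmetric] by (metis atLeastAtMost_iff not_less_eq_eq le_antisym)
  qed
  from this[of d] show ?thesis unfolding independent_on_def by (simp add: atMost_atLeast0)
qed

text \<open>A matrix with fewer rows than columns becomes square when zero rows are added, and then
  it has determinant zero.\<close>

lemma ex_kernel_wide:
  fixes X :: "nat \<Rightarrow> nat \<Rightarrow> complex"
  assumes "m < L"
  shows "\<exists>x. (\<exists>j<L. x j \<noteq> 0) \<and> (\<forall>i<m. (\<Sum>j<L. X i j * x j) = 0)"
proof -
  \<comment> \<open>Zero rows fill the matrix up to a square one, so the unit vector at position m is in the left kernel.\<close>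
  define Y where "Y = mat L L (\<lambda>(i, j). if i < m then X i j else 0)"
  have Y: "Y \<in> carrier_mat L L" by (simp add: Y_def)
  have "transpose_mat Y *\<^sub>v unit_vec L m = 0\<^sub>v L"
    using assms by (intro eq_vecI) (auto simp: Y_def scalar_prod_def intro!: sum.neutral)
  then have "det (transpose_mat Y) = 0"
    using assms Y by (subst det_0_iff_vec_prod_zero) (auto intro!: exI[of _ "unit_vec L m"])
  then obtain v where v: "v \<in> carrier_vec L" "v \<noteq> 0\<^sub>v L" "Y *\<^sub>v v = 0\<^sub>v L"
    using Y by (auto simp: det_transpose det_0_iff_vec_prod_zero)
  have "(\<Sum>j<L. X i j * v $ j) = 0" if "i < m" for i
  proof -
    have "(Y *\<^sub>v v) $ i = (\<Sum>j<L. X i j * v $ j)"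
      using that assms v(1) by (simp add: Y_def scalar_prod_def lessThan_atLeast0)
    then show ?thesis using that assms v(3) by simp
  qed
  moreover have "\<exists>j<L. v $ j \<noteq> 0"
  proof (rule ccontr)
    assume "\<not> ?thesis"
    then have "v = 0\<^sub>v L" using v(1) by (intro eq_vecI) auto
    then show False using v(2) by simp
  qed
  ultimately show ?thesis by blast
qed

text \<open>Spanning is stated dually: only the zero functional vanishes on the family. This is the form in
  which non-degeneracy of a curve provides it.\<close>

definition spanning_on :: "nat \<Rightarrow> nat set \<Rightarrow> (nat \<Rightarrow> nat \<Rightarrow> complex) \<Rightarrow> bool" where
  "spanning_on m K u \<longleftrightarrow>
     (\<forall>x. (\<forall>k\<in>K. (\<Sum>i<m. x i * u k i) = 0) \<longrightarrow> (\<forall>i<m. x i = 0))"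

text \<open>The matrix of the family has trivial kernel by independence and trivial left kernel by
  spanning, so it can be neither wide nor tall.\<close>

lemma card_basis:
  assumes K: "finite K" and ind: "independent_on m K u" and span: "spanning_on m K u"
  shows "card K = m"
proof -
  obtain h where h: "bij_betw h {..<card K} K"
    using ex_bij_betw_nat_finite[OF K] by (auto simp: lessThan_atLeast0)
  have "\<not> m < card K"
  proof
    assume "m < card K"
    then obtain x where x: "\<exists>j<card K. x j \<noteq> 0" "\<forall>i<m. (\<Sum>j<card K. u (h j) i * x j) = 0"
      using ex_kernel_wide[of m "card K" "\<lambda>i j. u (h j) i"] by blast
    define y where "y k = x (inv_into {..<card K} h k)" for k
    have y: "y (h j) = x j" if "j < card K" for j
      using that h by (simp add: y_def bij_betw_def inv_into_f_f)
    have "(\<Sum>k\<in>K. y k * u k i) = (\<Sum>j<card K. u (h j) i * x j)" for i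
      using sum.reindex_bij_betw[OF h, of "\<lambda>k. y k * u k i"] y by (simp add: mult.commute)
    then have "\<forall>k\<in>K. y k = 0" using ind x(2) unfolding independent_on_def by simp
    then show False using x(1) y h by (metis bij_betwE lessThan_iff)
  qed
  moreover have "\<not> card K < m"
  proof
    assume "card K < m"
    then obtain x where x: "\<exists>i<m. x i \<noteq> 0" "\<forall>j<card K. (\<Sum>i<m. u (h j) i * x i) = 0"
      using ex_kernel_wide[of "card K" m "\<lambda>j i. u (h j) i"] by blast
    have "(\<Sum>i<m. x i * u k i) = 0" if "k \<in> K" for k
    proof -
      have "k \<in> h ` {..<card K}" using that h by (simp add: bij_betw_imp_surj_on)
      then obtain j where "j < card K" "k = h j" by blast
      then show ?thesis using x(2) by (simp add: mult.commute)
    qed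
    then show False using span x(1) unfolding spanning_on_def by blast
  qed
  ultimately show ?thesis by simp
qed

text \<open>Coefficient vectors that are zero may be dropped from the spanning family, so that only the exponents that
  really occur remain.\<close>

lemma spanning_on_nonzero:
  assumes span: "spanning_on m J u"
  shows "spanning_on m {k \<in> J. \<exists>i<m. u k i \<noteq> 0} u"
  unfolding spanning_on_def
proof (intro allI impI)
  fix x i assume x: "\<forall>k\<in>{k \<in> J. \<exists>i<m. u k i \<noteq> 0}. (\<Sum>i<m. x i * u k i) = 0" and i: "i < m"
  have "(\<Sum>i<m. x i * u k i) = 0" if "k \<in> J" for k
  proof (cases "\<exists>i<m. u k i \<noteq> 0")
    case True
    then show ?thesis using x that by blast
  next
    case False
    then show ?thesis by simp
  qed
  then show "x i = 0" using span i unfolding spanning_on_def by blast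
qed

section \<open>Parametrized curves\<close>

definition parametrizes :: "nat \<Rightarrow> nat \<Rightarrow> (nat \<Rightarrow> complex \<Rightarrow> complex \<Rightarrow> complex) \<Rightarrow> point set \<Rightarrow> bool" where
  "parametrizes n d F S \<longleftrightarrow> form_tuple (Suc n) d F \<and> base_point_free (Suc n) F \<and>
     S = {tuple_point (Suc n) F z w | z w. z \<noteq> 0 \<or> w \<noteq> 0}"

definition coefficients :: "nat \<Rightarrow> nat \<Rightarrow> (nat \<Rightarrow> complex \<Rightarrow> complex \<Rightarrow> complex) \<Rightarrow>
    (nat \<Rightarrow> nat \<Rightarrow> complex) \<Rightarrow> bool" where
  "coefficients m d F u \<longleftrightarrow> (\<forall>i<m. \<forall>z w. F i z w = (\<Sum>k\<le>d. u k i * z ^ k * w ^ (d - k)))"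

lemma ex_coefficients:
  assumes "form_tuple m d F" shows "\<exists>u. coefficients m d F u"
proof -
  obtain q where q: "\<And>i. i < m \<Longrightarrow> F i = homogenize d (q i)"
    using assms unfolding form_tuple_def binary_form_def by metis
  show ?thesis unfolding coefficients_def
    by (rule exI[of _ "\<lambda>k i. coeff (q i) k"]) (simp add: q homogenize_def)
qed

text \<open>A functional that kills all coefficient vectors vanishes on the whole curve, so it would define a hyperplane
  containing \<open>S\<close>.\<close>

lemma coefficients_spanning:
  assumes S: "nondegenerate n S" and par: "parametrizes n d F S" and u: "coefficients (Suc n) d F u"
  shows "spanning_on (Suc n) {..d} u"
  unfolding spanning_on_def
proof (intro allI impI, rule ccontr)
  fix x i assume rel: "\<forall>k\<in>{..d}. (\<Sum>i<Suc n. x i * u k i) = 0" and i: "i < Suc n" "x i \<noteq> 0"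
  define a where "a = vec (Suc n) x"
  have "a \<noteq> 0\<^sub>v (Suc n)" using i by (metis a_def index_vec index_zero_vec(1))
  then have "hyperplane n {P \<in> CP n. \<forall>v\<in>P. a \<bullet> v = 0}"
    unfolding hyperplane_def by (intro bexI[of _ a]) (auto simp: a_def)
  moreover have "P \<in> CP n \<and> (\<forall>v\<in>P. a \<bullet> v = 0)" if "P \<in> S" for P
  proof -
    obtain z w where zw: "z \<noteq> 0 \<or> w \<noteq> 0" and P: "P = tuple_point (Suc n) F z w"
      using \<open>P \<in> S\<close> par by (auto simp: parametrizes_def)
    have "P \<in> CP n" unfolding P using zw par by (intro tuple_point_mem_CP) (auto simp: parametrizes_def)
    have "(\<Sum>i<Suc n. x i * F i z w) = (\<Sum>i<Suc n. \<Sum>k\<le>d. x i * u k i * (z ^ k * w ^ (d - k)))"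
      using u by (intro sum.cong) (auto simp: coefficients_def sum_distrib_left mult.assoc)
    also have "\<dots> = (\<Sum>k\<le>d. (\<Sum>i<Suc n. x i * u k i) * (z ^ k * w ^ (d - k)))"
      unfolding sum_distrib_right by (rule sum.swap)
    also have "\<dots> = 0" using rel by simp
    finally have zero: "(\<Sum>i<Suc n. x i * F i z w) = 0" .
    have "a \<bullet> v = 0" if "v \<in> P" for v
    proof -
      obtain c where v: "v = c \<cdot>\<^sub>v vec (Suc n) (\<lambda>i. F i z w)"
        using \<open>v \<in> P\<close> by (auto simp: P tuple_point_def proj_point_def)
      have "a \<bullet> v = (\<Sum>i<Suc n. x i * (c * F i z w))"
        unfolding scalar_prod_def v a_def by (intro sum.cong) auto
      also have "\<dots> = c * (\<Sum>i<Suc n. x i * F i z w)"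
        by (simp only: sum_distrib_left mult.left_commute)
      finally show ?thesis using zero by simp
    qed
    then show ?thesis using \<open>P \<in> CP n\<close> by blast
  qed
  ultimately show False using S unfolding nondegenerate_def by blast
qed

text \<open>An invertible linear substitution permutes the points of the line, so it changes neither the image nor
  the absence of base points. It serves to replace the lifted map by its normal form.\<close>

lemma parametrizes_linear_substitution:
  assumes par: "parametrizes n d F S" and det: "p * q' \<noteq> p' * q"
  shows "parametrizes n d (\<lambda>i z w. F i (p * z + q * w) (p' * z + q' * w)) S"
proof -
  define M where "M i z w = (if i = 0 then p * z + q * w else p' * z + q' * w)" for i :: nat and z w
  have M: "M 0 z w = p * z + q * w" "M 1 z w = p' * z + q' * w" for z w
    by (simp_all add: M_def)
  have "M 0 = (\<lambda>z w. p * z + q * w)" "M 1 = (\<lambda>z w. p' * z + q' * w)"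
    by (simp_all add: M_def fun_eq_iff)
  then have M_form: "form_tuple 2 1 M"
    using binary_form_linear[of p q] binary_form_linear[of p' q']
    by (auto simp: form_tuple_def less_2_cases_iff)
  have inv: "\<exists>z w. p * z + q * w = a \<and> p' * z + q' * w = b" for a b
  proof -
    define D where "D = p * q' - p' * q"
    have "D \<noteq> 0" using det by (simp add: D_def)
    then have "p * ((q' * a - q * b) / D) + q * ((p * b - p' * a) / D) = a"
      "p' * ((q' * a - q * b) / D) + q' * ((p * b - p' * a) / D) = b"
      by (simp_all add: field_simps, simp_all add: D_def algebra_simps)
    then show ?thesis by blast
  qed
  have ker: "p * z + q * w \<noteq> 0 \<or> p' * z + q' * w \<noteq> 0" if "z \<noteq> 0 \<or> w \<noteq> 0" for z w
  proof (rule ccontr)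
    assume "\<not> ?thesis"
    then have *: "p * z + q * w = 0" "p' * z + q' * w = 0" by auto
    have "(p * q' - p' * q) * z = q' * (p * z + q * w) - q * (p' * z + q' * w)"
      "(p * q' - p' * q) * w = p * (p' * z + q' * w) - p' * (p * z + q * w)"
      by (simp_all add: algebra_simps)
    then have "(p * q' - p' * q) * z = 0" "(p * q' - p' * q) * w = 0" unfolding * by simp_all
    then show False using det that by simp
  qed
  have "base_point_free 2 M"
    unfolding base_point_free_def
  proof (intro allI impI)
    fix z w :: complex assume "z \<noteq> 0 \<or> w \<noteq> 0"
    then have "M 0 z w \<noteq> 0 \<or> M 1 z w \<noteq> 0" unfolding M by (rule ker)
    then show "\<exists>i<2. M i z w \<noteq> 0" by (metis one_less_numeral_iff pos2 semiring_norm(76))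
  qed
  then have "base_point_free (Suc n) (\<lambda>i z w. F i (M 0 z w) (M 1 z w))"
    using par by (intro base_point_free_compose) (auto simp: parametrizes_def)
  moreover have "form_tuple (Suc n) (d * 1) (\<lambda>i z w. F i (M 0 z w) (M 1 z w))"
    using par M_form by (intro form_tuple_compose) (auto simp: parametrizes_def)
  moreover have "S = {tuple_point (Suc n) (\<lambda>i z w. F i (M 0 z w) (M 1 z w)) z w | z w. z \<noteq> 0 \<or> w \<noteq> 0}"
  proof (intro equalityI subsetI)
    fix P assume "P \<in> S"
    then obtain a b where ab: "a \<noteq> 0 \<or> b \<noteq> 0" "P = tuple_point (Suc n) F a b"
      using par by (auto simp: parametrizes_def)
    obtain z w where zw: "p * z + q * w = a" "p' * z + q' * w = b" using inv by blast
    then have "z \<noteq> 0 \<or> w \<noteq> 0" using ab(1) by auto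
    moreover have "P = tuple_point (Suc n) (\<lambda>i z w. F i (M 0 z w) (M 1 z w)) z w"
      unfolding ab(2) tuple_point_def M zw ..
    ultimately show "P \<in> {tuple_point (Suc n) (\<lambda>i z w. F i (M 0 z w) (M 1 z w)) z w | z w. z \<noteq> 0 \<or> w \<noteq> 0}"
      by blast
  next
    fix P assume "P \<in> {tuple_point (Suc n) (\<lambda>i z w. F i (M 0 z w) (M 1 z w)) z w | z w. z \<noteq> 0 \<or> w \<noteq> 0}"
    then obtain z w where zw: "z \<noteq> 0 \<or> w \<noteq> 0"
      "P = tuple_point (Suc n) (\<lambda>i z w. F i (M 0 z w) (M 1 z w)) z w" by blast
    have "P = tuple_point (Suc n) F (M 0 z w) (M 1 z w)" unfolding zw(2) tuple_point_def ..
    moreover have "M 0 z w \<noteq> 0 \<or> M 1 z w \<noteq> 0" unfolding M using zw(1) by (rule ker)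
    ultimately show "P \<in> S" using par unfolding parametrizes_def by blast
  qed
  ultimately show ?thesis unfolding parametrizes_def M by simp
qed

lemma coefficients_at_ends:
  assumes "coefficients m d F u" "i < m"
  shows "F i 0 1 = u 0 i" "F i 1 0 = u d i"
proof -
  have F: "F i z w = (\<Sum>k\<le>d. u k i * z ^ k * w ^ (d - k))" for z w
    using assms by (simp add: coefficients_def)
  have "F i 0 1 = (\<Sum>k\<le>d. if k = 0 then u 0 i else 0)"
    unfolding F by (intro sum.cong) auto
  then show "F i 0 1 = u 0 i" by simp
  have "F i 1 0 = (\<Sum>k\<le>d. if k = d then u d i else 0)"
    unfolding F by (intro sum.cong) auto
  then show "F i 1 0 = u d i" by simp
qed

lemma parametrizes_image:
  assumes f: "f ` CP 1 = S" and F: "form_tuple (Suc n) d F" "base_point_free (Suc n) F"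
    and fF: "\<And>z w. z \<noteq> 0 \<or> w \<noteq> 0 \<Longrightarrow> f (line_point z w) = tuple_point (Suc n) F z w"
  shows "parametrizes n d F S"
proof -
  have "P \<in> S \<longleftrightarrow> (\<exists>z w. P = tuple_point (Suc n) F z w \<and> (z \<noteq> 0 \<or> w \<noteq> 0))" for P
  proof
    assume "P \<in> S"
    then obtain Q where Q: "Q \<in> CP 1" "P = f Q" using f by blast
    from Q(1) obtain z w where "z \<noteq> 0 \<or> w \<noteq> 0" "Q = line_point z w" by (rule CP_1_cases)
    then show "\<exists>z w. P = tuple_point (Suc n) F z w \<and> (z \<noteq> 0 \<or> w \<noteq> 0)" using Q(2) fF by blast
  next
    assume "\<exists>z w. P = tuple_point (Suc n) F z w \<and> (z \<noteq> 0 \<or> w \<noteq> 0)"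
    then obtain z w where "P = f (line_point z w)" "z \<noteq> 0 \<or> w \<noteq> 0" using fF by metis
    then show "P \<in> S" using f line_point_mem_CP by blast
  qed
  then show ?thesis using F unfolding parametrizes_def by blast
qed

text \<open>A constant tuple has a single coefficient vector, which cannot span a space of dimension \<open>n + 1 \<ge> 2\<close>.\<close>

lemma parametrization_degree_pos:
  assumes S: "nondegenerate n S" and par: "parametrizes n d F S" and n: "n \<ge> 1"
  shows "d > 0"
proof (rule ccontr)
  assume "\<not> d > 0"
  then have d: "{..d} = {0}" by auto
  obtain v where "coefficients (Suc n) d F v"
    using ex_coefficients par unfolding parametrizes_def by blast
  then have span: "spanning_on (Suc n) {0} v"
    using coefficients_spanning[OF S par] d by simp
  have "1 < Suc n" using n by simp
  then obtain x where x: "\<exists>i<Suc n. x i \<noteq> 0" "\<forall>j<(1::nat). (\<Sum>i<Suc n. v 0 i * x i) = 0"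
    using ex_kernel_wide[of 1 "Suc n" "\<lambda>_. v 0"] by blast
  then have "\<forall>k\<in>{0}. (\<Sum>i<Suc n. x i * v k i) = 0"
    by (simp add: mult.commute del: sum.lessThan_Suc)
  then have "\<forall>i<Suc n. x i = 0" using span unfolding spanning_on_def by blast
  then show False using x(1) by blast
qed

section \<open>Coefficient vectors and monomial sets\<close>

lemma coefficients_eq:
  fixes \<alpha> \<beta> :: "nat \<Rightarrow> complex"
  assumes "\<And>z. (\<Sum>k\<le>d. \<alpha> k * z ^ k) = (\<Sum>k\<le>d. \<beta> k * z ^ k)" "k \<le> d"
  shows "\<alpha> k = \<beta> k"
  using assms polyfun_eq_coeffs[of \<alpha> d \<beta>] by blast

lemma coefficients_mat_tuple:
  assumes u: "coefficients m d F u" and i: "i < m"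
  shows "mat_tuple m A F i z w = (\<Sum>k\<le>d. (\<Sum>j<m. A $$ (i, j) * u k j) * z ^ k * w ^ (d - k))"
proof -
  have "mat_tuple m A F i z w = (\<Sum>j<m. \<Sum>k\<le>d. A $$ (i, j) * u k j * (z ^ k * w ^ (d - k)))"
    unfolding mat_tuple_def using u
    by (intro sum.cong) (auto simp: coefficients_def sum_distrib_left mult.assoc)
  also have "\<dots> = (\<Sum>k\<le>d. (\<Sum>j<m. A $$ (i, j) * u k j) * (z ^ k * w ^ (d - k)))"
    unfolding sum_distrib_right by (rule sum.swap)
  finally show ?thesis by (simp add: mult.assoc)
qed

lemma diagonal_coefficients:
  assumes u: "coefficients m d F u"
    and act: "\<And>i z w. i < m \<Longrightarrow> mat_tuple m A F i z w = c * F i (l * z) (r * w)"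
    and ki: "k \<le> d" "i < m"
  shows "(\<Sum>j<m. A $$ (i, j) * u k j) = c * l ^ k * r ^ (d - k) * u k i"
proof (rule coefficients_eq[of "\<lambda>k. \<Sum>j<m. A $$ (i, j) * u k j" d "\<lambda>k. c * l ^ k * r ^ (d - k) * u k i" k])
  fix z
  have "(\<Sum>k\<le>d. (\<Sum>j<m. A $$ (i, j) * u k j) * z ^ k) = mat_tuple m A F i z 1"
    using coefficients_mat_tuple[OF u ki(2)] by simp
  also have "\<dots> = c * (\<Sum>k\<le>d. u k i * (l * z) ^ k * (r * 1) ^ (d - k))"
    unfolding act[OF ki(2)] using u ki(2) by (simp add: coefficients_def)
  also have "\<dots> = (\<Sum>k\<le>d. c * l ^ k * r ^ (d - k) * u k i * z ^ k)"
    unfolding sum_distrib_left by (intro sum.cong) (auto simp: power_mult_distrib)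
  finally show "(\<Sum>k\<le>d. (\<Sum>j<m. A $$ (i, j) * u k j) * z ^ k) =
    (\<Sum>k\<le>d. c * l ^ k * r ^ (d - k) * u k i * z ^ k)" .
qed (rule ki(1))

text \<open>The binomial expansion of \<open>(z + 1)^h\<close>, collected by powers of \<open>z\<close>.\<close>

lemma unipotent_coefficients:
  assumes u: "coefficients m d F u"
    and act: "\<And>i z w. i < m \<Longrightarrow> mat_tuple m A F i z w = c * F i (l * z + l * w) (l * w)"
    and ki: "k \<le> d" "i < m"
  shows "(\<Sum>j<m. A $$ (i, j) * u k j) = c * l ^ d * (\<Sum>h\<in>{k..d}. of_nat (h choose k) * u h i)"
proof (rule coefficients_eq[of "\<lambda>k. \<Sum>j<m. A $$ (i, j) * u k j" d
      "\<lambda>k. c * l ^ d * (\<Sum>h\<in>{k..d}. of_nat (h choose k) * u h i)" k])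
  fix z
  have "(\<Sum>k\<le>d. (\<Sum>j<m. A $$ (i, j) * u k j) * z ^ k) = mat_tuple m A F i z 1"
    using coefficients_mat_tuple[OF u ki(2)] by simp
  also have "\<dots> = c * (\<Sum>h\<le>d. u h i * (l * z + l * 1) ^ h * (l * 1) ^ (d - h))"
    unfolding act[OF ki(2)] using u ki(2) by (simp add: coefficients_def)
  also have "\<dots> = c * (\<Sum>h\<le>d. l ^ d * (u h i * (z + 1) ^ h))"
  proof -
    have "u h i * (l * z + l * 1) ^ h * (l * 1) ^ (d - h) = l ^ d * (u h i * (z + 1) ^ h)"
      if "h \<le> d" for h
    proof -
      have "l * z + l * 1 = l * (z + 1)" by (simp add: algebra_simps)
      moreover have "l ^ d = l ^ h * l ^ (d - h)" using that by (simp flip: power_add)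
      ultimately show ?thesis by (simp add: power_mult_distrib)
    qed
    then show ?thesis by (intro arg_cong[of _ _ "\<lambda>x. c * x"] sum.cong) auto
  qed
  also have "\<dots> = c * l ^ d * (\<Sum>h\<le>d. u h i * (\<Sum>k\<le>h. of_nat (h choose k) * z ^ k))"
    by (simp add: binomial_ring sum_distrib_left[symmetric] mult.assoc)
  also have "(\<Sum>h\<le>d. u h i * (\<Sum>k\<le>h. of_nat (h choose k) * z ^ k)) =
      (\<Sum>h\<le>d. \<Sum>k\<le>h. of_nat (h choose k) * u h i * z ^ k)"
    by (simp add: sum_distrib_left mult.left_commute mult.assoc)
  also have "\<dots> = (\<Sum>k\<le>d. \<Sum>h\<in>{k..d}. of_nat (h choose k) * u h i * z ^ k)"
    unfolding sum.Sigma[OF finite_atMost ballI[OF finite_atMost]]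
      sum.Sigma[OF finite_atMost ballI[OF finite_atLeastAtMost]]
    by (rule sum.reindex_bij_witness[of _ "\<lambda>(h, k). (k, h)" "\<lambda>(k, h). (h, k)"]) auto
  also have "c * l ^ d * \<dots> =
      (\<Sum>k\<le>d. c * l ^ d * (\<Sum>h\<in>{k..d}. of_nat (h choose k) * u h i) * z ^ k)"
    by (simp add: sum_distrib_left sum_distrib_right mult.assoc)
  finally show "(\<Sum>k\<le>d. (\<Sum>j<m. A $$ (i, j) * u k j) * z ^ k) =
    (\<Sum>k\<le>d. c * l ^ d * (\<Sum>h\<in>{k..d}. of_nat (h choose k) * u h i) * z ^ k)" .
qed (rule ki(1))

text \<open>Since no exponent exceeds \<open>hd ks\<close>, all entries of the monomial vector are homogeneous of that degree, and the
  choice of the representative of the point does not matter.\<close>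

lemma monomial_curve_line_point:
  assumes le: "\<And>j. j \<le> length ks \<Longrightarrow> (ks @ [0]) ! j \<le> hd ks"
  shows "monomial_curve ks (line_point z w) = proj_point (monomial_vec ks z w)"
proof -
  have scale: "proj_point (monomial_vec ks (c * z) (c * w)) = proj_point (monomial_vec ks z w)"
    if "c \<noteq> 0" for c
  proof -
    have "monomial_vec ks (c * z) (c * w) = c ^ hd ks \<cdot>\<^sub>v monomial_vec ks z w"
    proof (rule eq_vecI)
      fix j assume "j < dim_vec (c ^ hd ks \<cdot>\<^sub>v monomial_vec ks z w)"
      then have j: "j < Suc (length ks)" by (simp add: monomial_vec_def)
      define e where "e = (ks @ [0]) ! j"
      have "e \<le> hd ks" using le j unfolding e_def by simp
      then have "c ^ hd ks = c ^ e * c ^ (hd ks - e)" by (simp flip: power_add)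
      then show "monomial_vec ks (c * z) (c * w) $ j = (c ^ hd ks \<cdot>\<^sub>v monomial_vec ks z w) $ j"
        using j by (simp add: monomial_vec_def e_def[symmetric] power_mult_distrib)
    qed (simp add: monomial_vec_def)
    then show ?thesis using that by (simp add: proj_point_smult)
  qed
  have "proj_point (monomial_vec ks (v $ 0) (v $ 1)) = proj_point (monomial_vec ks z w)"
    if "v \<in> line_point z w" for v
  proof -
    obtain c where c: "c \<noteq> 0" "v = c \<cdot>\<^sub>v vec 2 (\<lambda>i. coordinates i z w)"
      using \<open>v \<in> line_point z w\<close> by (auto simp: tuple_point_def proj_point_def)
    then have "v $ 0 = c * z" "v $ 1 = c * w" by (simp_all add: coordinates_def)
    then show ?thesis using scale[OF c(1)] by simp
  qed
  moreover have "line_point z w \<noteq> {}"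
    using self_mem_proj_point unfolding tuple_point_def by blast
  ultimately show ?thesis unfolding monomial_curve_def by blast
qed

text \<open>The matrix \<open>B\<close> whose columns are the basis vectors, in the order of decreasing exponents, maps the monomial
  vector to \<open>F\<close>; its inverse carries \<open>S\<close> to the monomial set. The last exponent is \<open>0\<close> and the first is \<open>d\<close>, which is
  why \<open>0\<close> and \<open>d\<close> have to be in \<open>K\<close>.\<close>

lemma monomial_if_coefficient_basis:
  assumes n: "n \<ge> 1" and par: "parametrizes n d F S" and u: "coefficients (Suc n) d F u"
    and K: "K \<subseteq> {..d}" "0 \<in> K" "d \<in> K"
    and outside: "\<And>k i. k \<le> d \<Longrightarrow> k \<notin> K \<Longrightarrow> i < Suc n \<Longrightarrow> u k i = 0"
    and ind: "independent_on (Suc n) K u" and span: "spanning_on (Suc n) K u"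
  shows "\<exists>T. monomial_set n T \<and> projectively_equivalent n S T"
proof -
  have finK: "finite K" using K(1) finite_subset by blast
  have cardK: "card K = Suc n" using card_basis[OF finK ind span] .
  define ks where "ks = rev (sorted_list_of_set (K - {0}))"
  have set_ks: "set ks = K - {0}" using finK by (simp add: ks_def)
  have len: "length ks = n" using finK cardK K(2) by (simp add: ks_def)
  have sorted: "sorted_wrt (>) ks"
    using strict_sorted_list_of_set[of "K - {0}"] by (simp add: ks_def sorted_wrt_rev)
  have mono: "monomial_exponents n ks"
    unfolding monomial_exponents_def using len sorted set_ks by simp
  have "d \<noteq> 0"
  proof
    assume "d = 0"
    then have "K \<subseteq> {0}" using K(1) by simp
    then have "card K \<le> 1" using card_mono[of "{0}" K] by simp
    then show False using cardK n by simp
  qed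
  then have "d \<in> set ks" using K(3) set_ks by simp
  have hd: "hd ks = d"
  proof (cases ks)
    case Nil
    then show ?thesis using \<open>d \<in> set ks\<close> by simp
  next
    case (Cons x xs)
    then have "x \<in> K" using set_ks by auto
    then show ?thesis using Cons sorted \<open>d \<in> set ks\<close> K(1) by fastforce
  qed
  define e where "e j = (ks @ [0]) ! j" for j
  have e: "bij_betw e {..<Suc n} K"
  proof -
    have "distinct (ks @ [0])" using set_ks by (simp add: ks_def)
    moreover have "set (ks @ [0]) = K" using set_ks K(2) by auto
    ultimately show ?thesis
      using bij_betw_nth[of "ks @ [0]" "{..<Suc n}" K] len by (simp add: e_def[abs_def])
  qed
  have e_le: "e j \<le> d" if "j < Suc n" for j
    using bij_betwE[OF e] K(1) that by auto
  have curve: "monomial_curve ks (line_point z w) = proj_point (monomial_vec ks z w)" for z w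
    using e_le len hd by (intro monomial_curve_line_point) (simp add: e_def)
  define B where "B = mat (Suc n) (Suc n) (\<lambda>(i, j). u (e j) i)"
  have B: "B \<in> carrier_mat (Suc n) (Suc n)" by (simp add: B_def)
  have "det B \<noteq> 0"
  proof
    assume "det B = 0"
    then obtain v where v: "v \<in> carrier_vec (Suc n)" "v \<noteq> 0\<^sub>v (Suc n)" "B *\<^sub>v v = 0\<^sub>v (Suc n)"
      using B by (auto simp: det_0_iff_vec_prod_zero)
    define x where "x k = v $ inv_into {..<Suc n} e k" for k
    have x: "x (e j) = v $ j" if "j < Suc n" for j
      using that e by (simp add: x_def bij_betw_def inv_into_f_f)
    have "(\<Sum>k\<in>K. x k * u k i) = 0" if i: "i < Suc n" for i
    proof -
      have "(\<Sum>k\<in>K. x k * u k i) = (\<Sum>j<Suc n. u (e j) i * v $ j)"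
        using sum.reindex_bij_betw[OF e, of "\<lambda>k. x k * u k i", symmetric] x
        by (simp add: mult.commute)
      also have "\<dots> = (B *\<^sub>v v) $ i"
        using i v(1) by (simp add: B_def scalar_prod_def lessThan_atLeast0)
      finally show ?thesis using v(3) i by simp
    qed
    then have "\<forall>k\<in>K. x k = 0" using ind unfolding independent_on_def by blast
    then have "v $ j = 0" if "j < Suc n" for j using x[OF that] bij_betwE[OF e] that by auto
    then have "v = 0\<^sub>v (Suc n)" using v(1) by (intro eq_vecI) auto
    then show False using v(2) by simp
  qed
  then have "B \<in> carrier (GL (Suc n))"
    using det_non_zero_imp_unit[OF B, of "()"] by (simp add: GL_def units_of_def)
  then obtain C where C: "C \<in> carrier (GL (Suc n))" "C * B = 1\<^sub>m (Suc n)" using GL_inverse by blast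
  have F: "vec (Suc n) (\<lambda>i. F i z w) = B *\<^sub>v monomial_vec ks z w" for z w
  proof (rule eq_vecI)
    fix i assume "i < dim_vec (B *\<^sub>v monomial_vec ks z w)"
    then have i: "i < Suc n" by (simp add: B_def)
    have "F i z w = (\<Sum>k\<le>d. u k i * z ^ k * w ^ (d - k))" using u i by (simp add: coefficients_def)
    also have "\<dots> = (\<Sum>k\<in>K. u k i * z ^ k * w ^ (d - k))"
      using K(1) outside i by (intro sum.mono_neutral_right) auto
    also have "\<dots> = (\<Sum>j<Suc n. u (e j) i * z ^ e j * w ^ (d - e j))"
      by (rule sum.reindex_bij_betw[OF e, symmetric])
    also have "\<dots> = (B *\<^sub>v monomial_vec ks z w) $ i"
      using i len hd unfolding B_def monomial_vec_def e_def
      by (simp add: scalar_prod_def lessThan_atLeast0 mult.assoc)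
    finally show "vec (Suc n) (\<lambda>i. F i z w) $ i = (B *\<^sub>v monomial_vec ks z w) $ i" using i by simp
  qed (simp add: B_def)
  have CF: "vec (Suc n) (\<lambda>i. mat_tuple (Suc n) C F i z w) = monomial_vec ks z w" for z w
  proof -
    have mono_vec: "monomial_vec ks z w \<in> carrier_vec (Suc n)" using len by (simp add: monomial_vec_def)
    have "C *\<^sub>v (B *\<^sub>v monomial_vec ks z w) = C * B *\<^sub>v monomial_vec ks z w"
      using assoc_mult_mat_vec[OF GL_carrier_mat[OF C(1)] B mono_vec] by simp
    then show ?thesis
      using mono_vec by (simp add: vec_mat_tuple[OF GL_carrier_mat[OF C(1)]] F C(2))
  qed
  let ?h = "scalar_mats (Suc n) #>\<^bsub>GL (Suc n)\<^esub> C"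
  let ?T = "monomial_curve ks ` CP 1"
  have h: "?h \<in> carrier (PGL (Suc n))"
    using group.rcosetsI[OF group_GL scalar_mats_subset C(1)] by (simp add: PGL_def FactGroup_def)
  have act: "PGL_act ?h (tuple_point (Suc n) F z w) = monomial_curve ks (line_point z w)" for z w
    unfolding PGL_act_tuple_point[OF C(1)] curve unfolding tuple_point_def CF ..
  have S: "S = (\<lambda>(z, w). tuple_point (Suc n) F z w) ` {(z, w). z \<noteq> 0 \<or> w \<noteq> 0}"
    using par by (auto simp: parametrizes_def)
  have CP1: "CP 1 = (\<lambda>(z, w). line_point z w) ` {(z, w). z \<noteq> 0 \<or> w \<noteq> 0}"
  proof (intro equalityI subsetI)
    fix P assume "P \<in> CP 1"
    then show "P \<in> (\<lambda>(z, w). line_point z w) ` {(z, w). z \<noteq> 0 \<or> w \<noteq> 0}"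
      by (rule CP_1_cases) auto
  qed (auto intro: line_point_mem_CP[unfolded One_nat_def])
  have image: "PGL_act ?h ` S = ?T"
    unfolding S CP1 image_image by (intro image_cong) (auto simp: act)
  have SCP: "S \<subseteq> CP n"
    using par tuple_point_mem_CP by (auto simp: parametrizes_def)
  have TCP: "?T \<subseteq> CP n"
  proof -
    have "base_point_free (Suc n) (mat_tuple (Suc n) C F)"
      using par base_point_free_mat_tuple[OF C(1)] by (simp add: parametrizes_def)
    then have "PGL_act ?h (tuple_point (Suc n) F z w) \<in> CP n" if "z \<noteq> 0 \<or> w \<noteq> 0" for z w
      unfolding PGL_act_tuple_point[OF C(1)] using that by (rule tuple_point_mem_CP)
    then show ?thesis unfolding image[symmetric] S by auto
  qed
  have "monomial_set n ?T" using mono unfolding monomial_set_def by blast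
  moreover have "projectively_equivalent n S ?T"
    unfolding projectively_equivalent_def using SCP TCP h image by blast
  ultimately show ?thesis by blast
qed

section \<open>The order of the transformation\<close>

lemma not_scalar_power:
  assumes A: "A \<in> carrier (GL m)" and ord: "group.ord (PGL m) (scalar_mats m #>\<^bsub>GL m\<^esub> A) = 0"
    and r: "r > (0::nat)"
  shows "A [^]\<^bsub>GL m\<^esub> r \<notin> scalar_mats m"
proof
  assume mem: "A [^]\<^bsub>GL m\<^esub> r \<in> scalar_mats m"
  interpret G: group "GL m" by (rule group_GL)
  interpret N: normal "scalar_mats m" "GL m" by (rule normal_scalar_mats)
  interpret Q: group "PGL m" by (rule group_PGL)
  let ?c = "\<lambda>A. scalar_mats m #>\<^bsub>GL m\<^esub> A"
  have c: "?c A \<in> carrier (PGL m)"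
    using A unfolding PGL_def FactGroup_def by (auto intro: G.rcosetsI[OF scalar_mats_subset])
  have "?c A [^]\<^bsub>PGL m\<^esub> k = ?c (A [^]\<^bsub>GL m\<^esub> k)" for k :: nat
  proof (induction k)
    case 0
    then show ?case using N.rcos_const[OF G.is_group N.one_closed]
      by (simp add: PGL_def FactGroup_def)
  next
    case (Suc k)
    then show ?case using A N.rcos_sum[of "A [^]\<^bsub>GL m\<^esub> k" A]
      by (simp add: PGL_def FactGroup_def)
  qed
  then have "?c A [^]\<^bsub>PGL m\<^esub> r = \<one>\<^bsub>PGL m\<^esub>"
    using N.rcos_const[OF G.is_group mem] by (simp add: PGL_def FactGroup_def)
  then show False using ord Q.ord_eq_0[OF c] r by simp
qed

text \<open>The \<open>r\<close>-th power acts as \<open>s\<close> on a spanning family, hence everywhere.\<close>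

lemma power_scalar_if_eigenvalues:
  assumes A: "A \<in> carrier (GL m)" and span: "spanning_on m K u"
    and eig: "\<And>k i. k \<in> K \<Longrightarrow> i < m \<Longrightarrow> (\<Sum>j<m. A $$ (i, j) * u k j) = \<nu> k * u k i"
    and pow: "\<And>k. k \<in> K \<Longrightarrow> \<nu> k ^ r = s" and s: "s \<noteq> 0"
  shows "A [^]\<^bsub>GL m\<^esub> (r::nat) \<in> scalar_mats m"
proof -
  interpret G: group "GL m" by (rule group_GL)
  have carrier: "A [^]\<^bsub>GL m\<^esub> r \<in> carrier_mat m m" for r :: nat
    using A by (intro GL_carrier_mat) simp
  have mult_vec: "(B *\<^sub>v vec m (u k)) $ i = (\<Sum>j<m. B $$ (i, j) * u k j)"
    if "B \<in> carrier_mat m m" "i < m" for B k i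
    using that by (simp add: scalar_prod_def lessThan_atLeast0)
  have A_vec: "A *\<^sub>v vec m (u k) = \<nu> k \<cdot>\<^sub>v vec m (u k)" if "k \<in> K" for k
    using GL_carrier_mat[OF A] that
    by (intro eq_vecI) (simp_all add: mult_vec eig del: index_mult_mat_vec)
  have pow_vec: "A [^]\<^bsub>GL m\<^esub> r *\<^sub>v vec m (u k) = \<nu> k ^ r \<cdot>\<^sub>v vec m (u k)" if k: "k \<in> K" for k r
  proof (induction r)
    case 0
    then show ?case by (simp add: GL_one)
  next
    case (Suc r)
    have "A [^]\<^bsub>GL m\<^esub> Suc r *\<^sub>v vec m (u k) = A [^]\<^bsub>GL m\<^esub> r *\<^sub>v (A *\<^sub>v vec m (u k))"
      using assoc_mult_mat_vec[OF carrier GL_carrier_mat[OF A], of "vec m (u k)"]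
      by (simp add: GL_mult)
    also have "\<dots> = \<nu> k \<cdot>\<^sub>v (A [^]\<^bsub>GL m\<^esub> r *\<^sub>v vec m (u k))"
      unfolding A_vec[OF k] by (rule mult_mat_vec[OF carrier]) simp
    finally show ?case unfolding Suc.IH by (simp add: smult_smult_assoc)
  qed
  define P where "P = A [^]\<^bsub>GL m\<^esub> r"
  have P: "P \<in> carrier_mat m m" unfolding P_def by (rule carrier)
  have "P $$ (i, h) = (if h = i then s else 0)" if i: "i < m" "h < m" for i h
  proof -
    define x where "x j = P $$ (i, j) - (if j = i then s else 0)" for j
    have "(\<Sum>j<m. x j * u k j) = 0" if k: "k \<in> K" for k
    proof -
      have "(\<Sum>j<m. x j * u k j) =
          (\<Sum>j<m. P $$ (i, j) * u k j) - (\<Sum>j<m. if j = i then s * u k j else 0)"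
        unfolding sum_subtractf[symmetric] by (intro sum.cong) (auto simp: x_def algebra_simps)
      also have "(\<Sum>j<m. P $$ (i, j) * u k j) = s * u k i"
        unfolding mult_vec[OF P i(1), symmetric] using pow_vec[OF k, of r] pow[OF k] i
        by (simp add: P_def del: index_mult_mat_vec)
      finally show ?thesis using i by simp
    qed
    then have "x h = 0" using span i unfolding spanning_on_def by blast
    then show ?thesis by (simp add: x_def)
  qed
  then have "P = s \<cdot>\<^sub>m 1\<^sub>m m" using P by (intro eq_matI) auto
  then show ?thesis using s unfolding P_def scalar_mats_def by blast
qed

text \<open>Two equal values would differ by a factor \<open>(l / m) ^ j\<close> with \<open>j > 0\<close>. The values are the eigenvalues of a
  transformation whose lift has the eigenvalues \<open>l\<close> and \<open>m\<close>.\<close>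

lemma inj_on_weighted_powers:
  fixes c l m :: complex
  assumes nz: "c \<noteq> 0" "l \<noteq> 0" "m \<noteq> 0" and no_root: "\<And>r. r > 0 \<Longrightarrow> l ^ r \<noteq> m ^ r"
  shows "inj_on (\<lambda>k. c * l ^ k * m ^ (d - k)) {..d}"
proof -
  have "c * l ^ k * m ^ (d - k) \<noteq> c * l ^ k' * m ^ (d - k')" if "k < k'" "k' \<le> d" for k k'
  proof
    assume "c * l ^ k * m ^ (d - k) = c * l ^ k' * m ^ (d - k')"
    then have eq: "l ^ k * m ^ (d - k) = l ^ k' * m ^ (d - k')"
      using nz by (simp add: mult.assoc)
    obtain j where j: "j > 0" "k' = k + j" using \<open>k < k'\<close> less_imp_add_positive by blast
    then have dk: "d - k = (d - k') + j" using that by simp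
    have "(l ^ k * m ^ (d - k')) * m ^ j = l ^ k * m ^ (d - k)"
      unfolding dk power_add by (simp only: mult.assoc)
    also have "\<dots> = (l ^ k * m ^ (d - k')) * l ^ j"
      unfolding eq by (subst (1) j(2)) (simp only: power_add mult_ac)
    finally have "l ^ j = m ^ j" using nz by simp
    then show False using no_root[OF j(1)] by simp
  qed
  then show ?thesis by (intro linorder_inj_onI) auto
qed

section \<open>Invariant rational curves\<close>

theorem lemma4p5:
  fixes n :: nat and g :: "complex mat set" and S :: "point set"
  assumes "n \<ge> 2"
    and "g \<in> carrier (PGL (Suc n))"
    and "group.ord (PGL (Suc n)) g = 0"
    and "irreducible_curve n S"
    and "rational_curve n S"
    and "nondegenerate n S"
    and "PGL_act g ` S = S"
  shows "\<exists>T. monomial_set n T \<and> projectively_equivalent n S T"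
proof -
  obtain A where A: "A \<in> carrier (GL (Suc n))"
    and g: "g = scalar_mats (Suc n) #>\<^bsub>GL (Suc n)\<^esub> A"
    using assms(2) by (auto simp: PGL_def FactGroup_def RCOSETS_def)
  have no_scalar_power: "A [^]\<^bsub>GL (Suc n)\<^esub> r \<notin> scalar_mats (Suc n)" if "r > 0" for r :: nat
    using not_scalar_power[OF A _ that] assms(3) g by simp
  obtain f where f: "birational_map 1 (CP 1) n S f" "f ` CP 1 = S"
    using assms(5) unfolding rational_curve_def normalization_map_def by blast
  then have "regular_map 1 (CP 1) n S f" unfolding birational_map_def by blast
  then obtain d F where F: "form_tuple (Suc n) d F" "base_point_free (Suc n) F"
    and fF: "\<And>z w. z \<noteq> 0 \<or> w \<noteq> 0 \<Longrightarrow> f (line_point z w) = tuple_point (Suc n) F z w"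
    using regular_map_global_forms by blast
  have par: "parametrizes n d F S" by (rule parametrizes_image[OF f(2) F fF])
  have n1: "n \<ge> 1" using assms(1) by simp
  have "d > 0" by (rule parametrization_degree_pos[OF assms(6) par n1])
  obtain a b a' b' c where det: "a * b' \<noteq> a' * b" and c: "c \<noteq> 0"
    and lift: "\<And>i z w. i < Suc n \<Longrightarrow>
      mat_tuple (Suc n) A F i z w = c * F i (a * z + b * w) (a' * z + b' * w)"
    using lift_linear[OF f F \<open>d > 0\<close> fF A assms(7)[unfolded g]] by blast
  obtain p q p' q' l m e where pq: "p * q' \<noteq> p' * q" and lm: "l \<noteq> 0" "m \<noteq> 0"
    and e: "e = 0 \<or> e = l \<and> m = l"
    and eig: "a * p + b * p' = l * p" "a' * p + b' * p' = l * p'"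
      "a * q + b * q' = m * q + e * p" "a' * q + b' * q' = m * q' + e * p'"
    using normal_form_2x2[OF det] by blast
  \<comment> \<open>In the parameters of the normal form, A acts on the curve by a diagonal matrix or a Jordan block.\<close>
  define G where "G i z w = F i (p * z + q * w) (p' * z + q' * w)" for i z w
  have parG: "parametrizes n d G S"
    unfolding G_def[abs_def] by (rule parametrizes_linear_substitution[OF par pq])
  then obtain u where u: "coefficients (Suc n) d G u"
    using ex_coefficients unfolding parametrizes_def by blast
  have span: "spanning_on (Suc n) {..d} u" by (rule coefficients_spanning[OF assms(6) parG u])
  have act: "mat_tuple (Suc n) A G i z w = c * G i (l * z + e * w) (m * w)" if "i < Suc n" for i z w
  proof -
    have "a * (p * z + q * w) + b * (p' * z + q' * w) = (a * p + b * p') * z + (a * q + b * q') * w"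
      by (simp add: algebra_simps)
    also have "\<dots> = p * (l * z + e * w) + q * (m * w)" unfolding eig by (simp add: algebra_simps)
    finally have 1: "a * (p * z + q * w) + b * (p' * z + q' * w) = p * (l * z + e * w) + q * (m * w)" .
    have "a' * (p * z + q * w) + b' * (p' * z + q' * w) = (a' * p + b' * p') * z + (a' * q + b' * q') * w"
      by (simp add: algebra_simps)
    also have "\<dots> = p' * (l * z + e * w) + q' * (m * w)" unfolding eig by (simp add: algebra_simps)
    finally have 2: "a' * (p * z + q * w) + b' * (p' * z + q' * w) = p' * (l * z + e * w) + q' * (m * w)" .
    have "mat_tuple (Suc n) A G i z w = mat_tuple (Suc n) A F i (p * z + q * w) (p' * z + q' * w)"
      by (simp only: mat_tuple_def G_def)
    then show ?thesis unfolding lift[OF that] 1 2 G_def .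
  qed
  have G_nz: "\<exists>i<Suc n. G i z w \<noteq> 0" if "z \<noteq> 0 \<or> w \<noteq> 0" for z w
    using parG that unfolding parametrizes_def base_point_free_def by blast
  have ends: "\<exists>i<Suc n. u 0 i \<noteq> 0" "\<exists>i<Suc n. u d i \<noteq> 0"
  proof -
    obtain i where i: "i < Suc n" "G i 0 1 \<noteq> 0" using G_nz[of 0 1] by force
    then show "\<exists>i<Suc n. u 0 i \<noteq> 0" unfolding coefficients_at_ends(1)[OF u i(1)] by blast
    obtain i where i: "i < Suc n" "G i 1 0 \<noteq> 0" using G_nz[of 1 0] by force
    then show "\<exists>i<Suc n. u d i \<noteq> 0" unfolding coefficients_at_ends(2)[OF u i(1)] by blast
  qed
  show ?thesis
  proof (cases "e = 0")
    case True
    define \<nu> where "\<nu> k = c * l ^ k * m ^ (d - k)" for k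
    have eigen: "(\<Sum>j<Suc n. A $$ (i, j) * u k j) = \<nu> k * u k i" if "k \<le> d" "i < Suc n" for k i
      unfolding \<nu>_def
    proof (rule diagonal_coefficients[OF u _ that])
      show "mat_tuple (Suc n) A G i z w = c * G i (l * z) (m * w)" if "i < Suc n" for i z w
        using act[OF that] True by simp
    qed
    \<comment> \<open>If l / m were a root of unity, a power of A would be scalar, against the infinite order of g.\<close>
    have no_root: "l ^ r \<noteq> m ^ r" if "r > 0" for r
    proof
      assume lr: "l ^ r = m ^ r"
      have pow: "\<nu> k ^ r = c ^ r * (l ^ r) ^ d" if "k \<in> {..d}" for k
      proof -
        have "\<nu> k ^ r = c ^ r * ((l ^ r) ^ k * (m ^ r) ^ (d - k))"
          by (simp add: \<nu>_def power_mult_distrib mult.assoc power_mult[symmetric] mult.commute)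
        also have "\<dots> = c ^ r * (l ^ r) ^ d"
          using that unfolding lr[symmetric] by (simp flip: power_add)
        finally show ?thesis .
      qed
      have "A [^]\<^bsub>GL (Suc n)\<^esub> r \<in> scalar_mats (Suc n)"
      proof (rule power_scalar_if_eigenvalues[OF A span _ pow])
        show "c ^ r * (l ^ r) ^ d \<noteq> 0" using c lm by simp
      qed (use eigen in \<open>simp_all only: atMost_iff\<close>)
      then show False using no_scalar_power[OF that] by simp
    qed
    have inj: "inj_on \<nu> {..d}"
      unfolding \<nu>_def[abs_def] by (rule inj_on_weighted_powers[OF c lm no_root])
    define K where "K = {k \<in> {..d}. (\<exists>i<Suc n. u k i \<noteq> 0)}"
    have K: "K \<subseteq> {..d}" "finite K" by (auto simp: K_def intro: finite_subset[of _ "{..d}"])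
    have "independent_on (Suc n) K u"
    proof (rule eigenvectors_independent[OF K(2), of "Suc n" A u \<nu>])
      show "inj_on \<nu> K" using inj K(1) by (rule inj_on_subset)
      show "(\<Sum>j<Suc n. A $$ (i, j) * u k j) = \<nu> k * u k i" if "k \<in> K" "i < Suc n" for k i
        using that K(1) by (intro eigen) auto
    qed (simp add: K_def)
    moreover have "spanning_on (Suc n) K u"
      unfolding K_def by (rule spanning_on_nonzero[OF span])
    moreover have "0 \<in> K" "d \<in> K" using ends by (simp_all add: K_def)
    ultimately show ?thesis
      using K(1) by (intro monomial_if_coefficient_basis[OF n1 parG u]) (auto simp: K_def)
  next
    case False
    then have e': "e = l" "m = l" using e by auto
    have "(\<Sum>j<Suc n. A $$ (i, j) * u k j) = c * l ^ d * (\<Sum>h\<in>{k..d}. of_nat (h choose k) * u h i)"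
      if "k \<le> d" "i < Suc n" for k i
    proof (rule unipotent_coefficients[OF u _ that])
      show "mat_tuple (Suc n) A G i z w = c * G i (l * z + l * w) (l * w)" if "i < Suc n" for i z w
        using act[OF that] e' by simp
    qed
    then have "independent_on (Suc n) {..d} u"
      using c lm by (intro unipotent_independent[of d "Suc n" A u "c * l ^ d", OF _ _ ends(2)]) simp_all
    then show ?thesis
      using span by (intro monomial_if_coefficient_basis[OF n1 parG u]) auto
  qed
qed

end
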